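(* For all $n \geq 0$, $$p_{\xi}(48n+4) \equiv p_{\xi}(12n+1) \equiv \begin{cases} 2(-1)^k \pmod{8}, & \text{if } n=k(3k-1) \text{ for some integer } k,\\ 0 \pmod{8}, & \text{otherwise}.\end{cases}$$
   Context: $(a;q)_n=(1-a)(1-aq)\cdots(1-aq^{n-1})$, $(a;q)_0=1$. The coefficients $p_\xi(n)$ are defined by $\sum_{n\ge0}p_\xi(n)q^n=\xi(q)=1+2\sum_{n\ge1}\frac{q^{6n^2-6n+1}}{(q;q^6)_n(q^5;q^6)_n}$. *)

theory Defs
  imports "HOL-Analysis.Analysis" "HOL-Computational_Algebra.Formal_Power_Series"
    "HOL-Number_Theory.Cong"
begin

definition qpoch :: "'a::comm_ring_1 \<Rightarrow> 'a \<Rightarrow> nat \<Rightarrow> 'a" where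
  "qpoch a q n = (\<Prod>i<n. 1 - a * q ^ i)"

definition xi_denom :: "nat \<Rightarrow> int fps" where
  "xi_denom n = qpoch fps_X (fps_X ^ 6) n * qpoch (fps_X ^ 5) (fps_X ^ 6) n"

text \<open>
  The coefficients must be integers for the congruences to make sense, so everything takes place in
  the ring of formal power series over the integers.  As the integers have no \<open>inverse\<close> operation,
  the reciprocal of the denominator, whose constant term is 1, is formed by
  \<^term>\<open>fps_right_inverse\<close>; lemma \<open>xi_denom_inverse\<close> below confirms that it is the inverse.
\<close>

definition xi_term :: "nat \<Rightarrow> int fps" where
  "xi_term n = fps_X ^ (6 * n\<^sup>2 - 6 * n + 1) * fps_right_inverse (xi_denom n) 1"

text \<open>The infinite sum is a limit in the X-adic topology; it converges by \<open>summable_xi_term\<close>.\<close>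

definition xi :: "int fps" where
  "xi = 1 + 2 * (\<Sum>n. xi_term (Suc n))"

definition p_xi :: "nat \<Rightarrow> int" where
  "p_xi n = fps_nth xi n"

lemma fps_nth_0_prod: "fps_nth (\<Prod>i\<in>A. f i) 0 = (\<Prod>i\<in>A. fps_nth (f i) 0)"
  for f :: "'b \<Rightarrow> 'a::comm_ring_1 fps"
  by (induction A rule: infinite_finite_induct) auto

lemma xi_denom_nth_0: "fps_nth (xi_denom n) 0 = 1"
  by (simp add: xi_denom_def qpoch_def fps_nth_0_prod)

lemma xi_denom_inverse: "xi_denom n * fps_right_inverse (xi_denom n) 1 = 1"
  by (rule fps_right_inverse) (simp add: xi_denom_nth_0)

lemma xi_term_nth_eq_0:
  assumes "k \<le> n"
  shows "fps_nth (xi_term (Suc n)) k = 0"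
proof -
  have "6 * (Suc n)\<^sup>2 - 6 * Suc n = 6 * n * Suc n"
    by (simp add: power2_eq_square algebra_simps)
  moreover have "n \<le> n * Suc n" by simp
  ultimately have "k < 6 * (Suc n)\<^sup>2 - 6 * Suc n + 1"
    using assms by linarith
  then show ?thesis
    by (simp only: xi_term_def fps_X_power_mult_nth if_True)
qed

lemma summable_xi_term: "summable (\<lambda>n. xi_term (Suc n))"
proof -
  let ?L = "Abs_fps (\<lambda>k. \<Sum>n<k. fps_nth (xi_term (Suc n)) k)"
  have "(\<lambda>N. \<Sum>n<N. xi_term (Suc n)) \<longlonglongrightarrow> ?L"
  proof (rule tendsto_fpsI)
    fix k
    show "\<forall>\<^sub>F N in sequentially. fps_nth (\<Sum>n<N. xi_term (Suc n)) k = fps_nth ?L k"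
      using eventually_ge_at_top[of k]
    proof eventually_elim
      case (elim N)
      have "(\<Sum>n<k. fps_nth (xi_term (Suc n)) k) = (\<Sum>n<N. fps_nth (xi_term (Suc n)) k)"
        using elim by (intro sum.mono_neutral_left) (auto intro: xi_term_nth_eq_0)
      then show ?case by (simp add: fps_sum_nth)
    qed
  qed
  then show ?thesis
    unfolding summable_def sums_def by blast
qed

end

theory Submission
  imports Defs
begin

text \<open>
  Write \<open>f\<^sub>m\<close> for the product of the \<open>1 - X ^ (m * i)\<close> over \<open>i \<ge> 1\<close>.  Expanding the reciprocals of the
  denominators of \<open>\<xi>\<close> into partial fractions and summing with the \<open>q\<close>-Vandermonde identity turns
  \<open>(\<xi> - 1) / 2\<close> into \<open>X / f\<^sub>6\<close> times the sum over \<open>j \<ge> 0\<close> of \<open>(-1) ^ j * X ^ (9 * j * (j + 1)) * g\<^sub>j\<close>, where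
  \<open>g\<^sub>j = 1 / (1 - X ^ (6 * j + 1)) + 1 / (1 - X ^ (6 * j + 5)) - 1\<close>.  Taking every third coefficient
  leaves \<open>g\<^sub>j\<close> unchanged and replaces the \<open>9\<close> by \<open>3\<close>, and the resulting sum is the limit of the same
  partial fractions.  This gives \<open>p\<^sub>\<xi>(3n+1) = 2 c(n)\<close>, where the generating function \<open>G\<close> of \<open>c\<close> is
  \<open>f\<^sub>3 f\<^sub>6 / f\<^sub>1\<close>.

  With \<open>\<phi>(X) = \<Sum> (-1)\<^sup>j X ^ j\<^sup>2\<close>, \<open>A(X) = \<Sum> X ^ (j(3j-1)/2)\<close> and \<open>B(X) = \<Sum> X ^ (3j\<^sup>2-2j)\<close>, the sums being over all
  integers, Jacobi's triple product gives \<open>G(X) \<phi>(X\<^sup>2) = B(X) \<phi>(X\<^sup>6)\<close> and \<open>A(X) \<phi>(X) = \<phi>(X\<^sup>3) f\<^sub>1\<close>.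
  Since \<open>\<phi>\<^sup>2 \<equiv> 1\<close> modulo 4, \<open>G \<equiv> B(X) \<psi>(X\<^sup>2)\<close> for \<open>\<psi>(X) = \<phi>(X) \<phi>(X\<^sup>3)\<close>.  Moreover
  \<open>B(X) = A(X\<^sup>8) + X B(X\<^sup>4)\<close>, and the even part of \<open>\<psi>\<close> is \<open>\<psi>(X\<^sup>4)\<close> modulo 4.  Two successive
  bisections therefore give \<open>c(4n+1) \<equiv> c(n)\<close> and \<open>\<Sum> c(4n) X\<^sup>n \<equiv> A(X\<^sup>2) \<psi>(X\<^sup>2) \<equiv> f\<^sub>2\<close> modulo 4, and Euler's
  pentagonal number theorem expands \<open>f\<^sub>2\<close>.
\<close>

subsection \<open>Finite \<open>q\<close>-series identities\<close>

lemma qpoch_0 [simp]: "qpoch a q 0 = 1"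
  by (simp add: qpoch_def)

lemma qpoch_Suc: "qpoch a q (Suc n) = qpoch a q n * (1 - a * q ^ n)"
  by (simp add: qpoch_def)

text \<open>\<open>R n\<close> stands for \<open>1 / (Q; Q)_n\<close>. Postulating these reciprocals
  lets the finite identities be proved in any commutative ring that has them, such as power series
  over the integers.\<close>

locale q_factorial_inverse =
  fixes Q :: "'a::comm_ring_1" and R :: "nat \<Rightarrow> 'a"
  assumes qpoch_R: "qpoch Q Q n * R n = 1"
begin

lemma R_0 [simp]: "R 0 = 1"
  using qpoch_R[of 0] by simp

lemma R_Suc: "R (Suc n) * (1 - Q ^ Suc n) = R n"
proof -
  have "R (Suc n) * (1 - Q ^ Suc n) = qpoch Q Q n * R n * (R (Suc n) * (1 - Q ^ Suc n))"
    by (simp add: qpoch_R)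
  also have "\<dots> = R n * (qpoch Q Q (Suc n) * R (Suc n))"
    by (simp add: qpoch_Suc algebra_simps)
  finally show ?thesis by (simp add: qpoch_R)
qed

lemma R_diff: "R (n - m) * (1 - Q ^ (n - m)) = R (n - Suc m)" if "m < n"
  using R_Suc[of "n - Suc m"] that by (simp add: Suc_diff_Suc)

text \<open>\<open>1 - Q ^ Suc n\<close> divides the invertible \<open>qpoch Q Q (Suc n)\<close>, so
  it is a unit. Several inductions below multiply by such a factor and cancel it at the end.\<close>

lemma mult_one_minus_power_cancel:
  assumes "a * (1 - Q ^ Suc n) = b * (1 - Q ^ Suc n)"
  shows "a = b"
proof -
  have *: "(1 - Q ^ Suc n) * (qpoch Q Q n * R (Suc n)) = 1"
    using qpoch_R[of "Suc n"] by (simp add: qpoch_Suc algebra_simps)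
  have "a * ((1 - Q ^ Suc n) * (qpoch Q Q n * R (Suc n))) = b * ((1 - Q ^ Suc n) * (qpoch Q Q n * R (Suc n)))"
    using assms by (metis mult.assoc)
  then show ?thesis unfolding * by simp
qed

text \<open>The induction multiplies by
  \<open>1 - Q ^ Suc M = (1 - Q ^ m) + Q ^ m * (1 - Q ^ (Suc M - m))\<close>. After an index shift
  in the first part, the two parts together form the case \<open>M\<close>, \<open>s + 1\<close>;
  hence \<open>s\<close> stays arbitrary.\<close>

lemma q_Vandermonde:
  "(\<Sum>m\<le>M. Q ^ (m * (m + s)) * R (M - m) * R m * R (m + s)) = R M * R (M + s)"
proof (induction M arbitrary: s)
  case 0
  then show ?case by simp
next
  case (Suc M)
  let ?t = "\<lambda>m. Q ^ (m * (m + s)) * R (Suc M - m) * R m * R (m + s)"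
  let ?u = "\<lambda>m. Q ^ (m * (m + s)) * Q ^ m * R (M - m) * R m * R (m + s)"
  let ?v = "\<lambda>m. Q ^ (Suc m * (Suc m + s)) * R (M - m) * R m * R (Suc m + s)"
  let ?w = "\<lambda>m. Q ^ (m * (m + s)) * R (Suc M - m) * (1 - Q ^ m) * R m * R (m + s)"
  have 1: "?t m * (1 - Q ^ Suc M) = ?w m + ?u m" if "m \<le> M" for m
  proof -
    have q: "Q ^ Suc M = Q ^ m * Q ^ (Suc M - m)"
      using that by (simp flip: power_add)
    have R: "R (M - m) = R (Suc M - m) * (1 - Q ^ (Suc M - m))"
      using R_diff[of m "Suc M"] that by simp
    show ?thesis unfolding q R by (simp add: algebra_simps)
  qed
  have "(\<Sum>m\<le>Suc M. ?t m) * (1 - Q ^ Suc M)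
      = (\<Sum>m\<le>M. ?t m * (1 - Q ^ Suc M)) + ?t (Suc M) * (1 - Q ^ Suc M)"
    by (simp only: sum.atMost_Suc distrib_right sum_distrib_right)
  also have "(\<Sum>m\<le>M. ?t m * (1 - Q ^ Suc M)) = (\<Sum>m\<le>M. ?w m + ?u m)"
    by (intro sum.cong refl 1) simp
  also have "\<dots> + ?t (Suc M) * (1 - Q ^ Suc M) = (\<Sum>m\<le>Suc M. ?w m) + (\<Sum>m\<le>M. ?u m)"
    by (simp only: sum.distrib sum.atMost_Suc) (simp add: ac_simps)
  also have "(\<Sum>m\<le>Suc M. ?w m) = (\<Sum>m\<le>M. ?v m)"
  proof -
    have "Q ^ (Suc m * (Suc m + s)) * R (Suc M - Suc m) * (1 - Q ^ Suc m) * R (Suc m) * R (Suc m + s)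
       = ?v m" for m
      by (subst R_Suc[of m, symmetric]) (simp add: ac_simps)
    then show ?thesis by (subst sum.atMost_Suc_shift) simp
  qed
  also have "(\<Sum>m\<le>M. ?v m) + (\<Sum>m\<le>M. ?u m)
      = (\<Sum>m\<le>M. Q ^ (m * (m + Suc s)) * R (M - m) * R m * R (m + Suc s))"
  proof -
    \<comment> \<open>The exponents differ by \<open>m + s + 1\<close>, the power in the factor
      \<open>1 - Q ^ (m + s + 1)\<close> that turns \<open>R (m + s + 1)\<close> into
      \<open>R (m + s)\<close>, so the sum collapses to one term.\<close>
    have "?v m + ?u m = Q ^ (m * (m + Suc s)) * R (M - m) * R m * R (m + Suc s)" for m
      by (subst R_Suc[of "m + s", symmetric]) (simp add: algebra_simps power_add)
    then show ?thesis by (simp flip: sum.distrib)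
  qed
  also have "\<dots> = R M * R (M + Suc s)"
    by (rule Suc.IH)
  also have "\<dots> = R (Suc M) * R (Suc M + s) * (1 - Q ^ Suc M)"
    by (subst R_Suc[of M, symmetric]) (simp add: algebra_simps)
  finally show ?case by (rule mult_one_minus_power_cancel)
qed

text \<open>A telescoping sum; for \<open>m = n > 0\<close> the right-hand side vanishes.\<close>

lemma partial_fraction_aux:
  "m \<le> n \<Longrightarrow> (\<Sum>j\<le>m. (-1) ^ j * Q ^ (j * (j + 1) div 2 + n - j) * (1 - Q ^ (2 * j + 1)) * R (n - j) * R (n + j + 1)) * (1 - Q ^ n)
   = (-1) ^ m * Q ^ (m * (m + 1) div 2 + n) * (1 - Q ^ (m + 1)) * (1 - Q ^ (n - m)) * R (n - m) * R (n + m + 1)"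
proof (induction m)
  case 0
  then show ?case by (simp add: algebra_simps)
next
  case (Suc m)
  have tri: "Suc m * (Suc m + 1) div 2 = m * (m + 1) div 2 + Suc m"
    by simp
  define i where "i = n - Suc m"
  have n: "n = Suc (i + m)"
    using Suc.prems by (simp add: i_def)
  define T where "T = m * (m + 1) div 2"
  have IH: "(\<Sum>j\<le>m. (-1) ^ j * Q ^ (j * (j + 1) div 2 + n - j) * (1 - Q ^ (2 * j + 1)) * R (n - j) * R (n + j + 1)) * (1 - Q ^ n)
     = (-1) ^ m * Q ^ (T + n) * (1 - Q ^ (m + 1)) * R i * (R (n + Suc m + 1) * (1 - Q ^ (n + m + 2)))"
  proof -
    have "(1 - Q ^ (n - m)) * R (n - m) = R i"
      using R_Suc[of i] by (simp add: n ac_simps)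
    moreover have "R (n + Suc m + 1) * (1 - Q ^ (n + m + 2)) = R (n + m + 1)"
      using R_Suc[of "n + m + 1"] by (simp add: ac_simps)
    ultimately show ?thesis
      using Suc by (simp add: T_def mult.assoc)
  qed
  show ?case
    unfolding sum.atMost_Suc distrib_right IH tri T_def[symmetric]
    by (simp add: n algebra_simps power_add mult_2 mult_2_right)
qed


text \<open>Partial fractions of \<open>1 / ((x; Q)_(n+1) * (y; Q)_(n+1))\<close>. Multiplying the
  expansion for \<open>n + 1\<close> by its newest denominator factor leaves the expansion for
  \<open>n\<close> plus a sum that vanishes by telescoping.\<close>

lemma partial_fraction:
  assumes xy: "x * y = Q" and W: "\<And>j. W j * ((1 - x * Q ^ j) * (1 - y * Q ^ j)) = 1"
  shows "(\<Prod>i\<le>n. W i)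
    = (\<Sum>j\<le>n. (-1) ^ j * Q ^ (j * (j + 1) div 2) * (1 - Q ^ (2 * j + 1)) * W j * R (n - j) * R (n + j + 1))"
proof (induction n)
  case 0
  have "R (Suc 0) * (1 - Q) = 1"
    using R_Suc[of 0] by simp
  then show ?case
    using arg_cong[of _ _ "(*) (W 0)"] by (simp add: ac_simps)
next
  case (Suc n)
  define u where "u j = (1 - x * Q ^ j) * (1 - y * Q ^ j)" for j
  have Wu: "W j * u j = 1" for j
    using W[of j] by (simp add: u_def)
  define r where "r j = (-1) ^ j * Q ^ (j * (j + 1) div 2) * (1 - Q ^ (2 * j + 1))" for j
  let ?t = "\<lambda>j. r j * W j * R (Suc n - j) * R (Suc n + j + 1)"
  let ?s = "\<lambda>n j. r j * W j * R (n - j) * R (n + j + 1)"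
  let ?z = "\<lambda>j. r j * Q ^ (Suc n - j) * R (Suc n - j) * R (Suc n + j + 1)"
  have split: "?s (Suc n) j * u (Suc n) = (if j \<le> n then ?s n j else 0) + ?z j" if "j \<le> Suc n" for j
  proof -
    define i where "i = Suc n - j"
    have n: "Suc n = i + j" using that by (simp add: i_def)
    \<comment> \<open>The condition \<open>x * y = Q\<close> makes the remainder independent of
      \<open>x\<close> and \<open>y\<close>. The first summand cancels \<open>W j\<close>, the
      second lowers both indices of \<open>R\<close>.\<close>
    have ui: "u (Suc n) = Q ^ i * u j + (1 - Q ^ i) * (1 - Q ^ (Suc n + j + 1))"
      unfolding n u_def xy[symmetric] by (simp add: algebra_simps power_add power_mult_distrib mult_2)
    have R1: "R (Suc n + j + 1) * (1 - Q ^ (Suc n + j + 1)) = R (n + j + 1)"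
      using R_Suc[of "n + j + 1"] by simp
    \<comment> \<open>At \<open>j = Suc n\<close> the factor \<open>1 - Q ^ i\<close> is 0, so the
      new index adds nothing to the sum for \<open>n\<close>.\<close>
    have R2: "R i * (1 - Q ^ i) = (if j \<le> n then R (n - j) else 0)"
      using R_diff[of j "Suc n"] that by (auto simp: i_def le_Suc_eq)
    have "?s (Suc n) j * u (Suc n) = r j * Q ^ i * R i * R (Suc n + j + 1) * (W j * u j)
        + r j * W j * (R i * (1 - Q ^ i)) * (R (Suc n + j + 1) * (1 - Q ^ (Suc n + j + 1)))"
      unfolding ui i_def by (simp add: algebra_simps)
    also have "\<dots> = (if j \<le> n then ?s n j else 0) + ?z j"
      unfolding R1 R2 Wu by (simp add: i_def)
    finally show ?thesis .
  qed
  have z: "(\<Sum>j\<le>Suc n. ?z j) = 0"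
  proof -
    have "Q ^ (j * (j + 1) div 2 + Suc n - j) = Q ^ (j * (j + 1) div 2) * Q ^ (Suc n - j)" if "j \<le> Suc n" for j
      using that by (simp flip: power_add)
    then have "(\<Sum>j\<le>Suc n. ?z j) = (\<Sum>j\<le>Suc n. (-1) ^ j * Q ^ (j * (j + 1) div 2 + Suc n - j)
        * (1 - Q ^ (2 * j + 1)) * R (Suc n - j) * R (Suc n + j + 1))"
      by (intro sum.cong refl) (simp add: r_def ac_simps)
    then have "(\<Sum>j\<le>Suc n. ?z j) * (1 - Q ^ Suc n) = 0 * (1 - Q ^ Suc n)"
      using partial_fraction_aux[of "Suc n" "Suc n"] by simp
    then show ?thesis by (rule mult_one_minus_power_cancel)
  qed
  have "(\<Sum>j\<le>Suc n. ?s (Suc n) j) * u (Suc n) = (\<Sum>j\<le>Suc n. (if j \<le> n then ?s n j else 0) + ?z j)"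
    unfolding sum_distrib_right by (intro sum.cong refl split) simp
  also have "\<dots> = (\<Sum>j\<le>n. ?s n j)"
    unfolding sum.distrib z by simp
  also have "\<dots> = (\<Prod>i\<le>n. W i)"
    using Suc.IH by (simp add: r_def)
  finally have "(\<Sum>j\<le>Suc n. ?s (Suc n) j) * (W (Suc n) * u (Suc n)) = (\<Prod>i\<le>n. W i) * W (Suc n)"
    by (simp add: ac_simps)
  then show ?case unfolding Wu by (simp add: r_def)
qed

text \<open>A finite case of Bailey's lemma: insert the partial fractions and interchange the sums.
  With \<open>n = m + j\<close> the inner sum is \<open>q_Vandermonde\<close> for
  \<open>s = 2 * j + 1\<close>.\<close>

lemma finite_Bailey:
  assumes xy: "x * y = Q" and W: "\<And>j. W j * ((1 - x * Q ^ j) * (1 - y * Q ^ j)) = 1"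
  shows "(\<Sum>n\<le>N. R (N - n) * Q ^ (n * (n + 1)) * (\<Prod>i\<le>n. W i))
    = (\<Sum>j\<le>N. (-1) ^ j * Q ^ (j * (j + 1) div 2) * (1 - Q ^ (2 * j + 1)) * W j * Q ^ (j * (j + 1))
         * R (N - j) * R (N + j + 1))"
proof -
  define r where "r j = (-1) ^ j * Q ^ (j * (j + 1) div 2) * (1 - Q ^ (2 * j + 1)) * W j" for j
  let ?f = "\<lambda>n j. r j * (Q ^ (n * (n + 1)) * R (N - n) * R (n - j) * R (n + j + 1))"
  have "(\<Sum>n\<le>N. R (N - n) * Q ^ (n * (n + 1)) * (\<Prod>i\<le>n. W i)) = (\<Sum>n\<le>N. \<Sum>j\<le>n. ?f n j)"
    by (simp only: partial_fraction[OF assms] sum_distrib_left r_def ac_simps)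
  also have "\<dots> = (\<Sum>j\<le>N. \<Sum>n=j..N. ?f n j)"
  proof -
    have "{..n} = {j \<in> {..N}. j \<le> n}" "{j..N} = {n \<in> {..N}. j \<le> n}" if "n \<le> N" for n j
      using that by auto
    then show ?thesis
      using sum.swap_restrict[of "{..N}" "{..N}" ?f "\<lambda>n j. j \<le> n"] by simp
  qed
  also have "\<dots> = (\<Sum>j\<le>N. r j * Q ^ (j * (j + 1)) * R (N - j) * R (N + j + 1))"
  proof (intro sum.cong refl)
    fix j assume j: "j \<in> {..N}"
    have "(\<Sum>n=j..N. ?f n j) = (\<Sum>m\<le>N - j. ?f (m + j) j)"
      using j by (intro sum.reindex_bij_witness[of _ "\<lambda>m. m + j" "\<lambda>n. n - j"]) auto
    also have "\<dots> = r j * Q ^ (j * (j + 1))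
        * (\<Sum>m\<le>N - j. Q ^ (m * (m + (2 * j + 1))) * R (N - j - m) * R m * R (m + (2 * j + 1)))"
    proof -
      have "Q ^ ((m + j) * (m + j + 1)) = Q ^ (j * (j + 1)) * Q ^ (m * (m + (2 * j + 1)))" for m
        unfolding power_add[symmetric] by (rule arg_cong[of _ _ "(^) Q"]) algebra
      moreover have "N - (m + j) = N - j - m" "m + j + j + 1 = m + (2 * j + 1)" for m
        by simp_all
      ultimately show ?thesis
        by (simp only: sum_distrib_left add_diff_cancel_right' mult_ac)
    qed
    also have "\<dots> = r j * Q ^ (j * (j + 1)) * R (N - j) * R (N + j + 1)"
      using j by (simp only: q_Vandermonde) (simp add: ac_simps mult_2)
    finally show "(\<Sum>n=j..N. ?f n j) = r j * Q ^ (j * (j + 1)) * R (N - j) * R (N + j + 1)" .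
  qed
  finally show ?thesis by (simp add: r_def)
qed

section \<open>Finite form of Jacobi's triple product\<close>

definition RI :: "int \<Rightarrow> 'a" where
  "RI k = (if k < 0 then 0 else R (nat k))"

lemma RI_of_nat [simp]: "RI (int k) = R k"
  by (simp add: RI_def)

text \<open>Extending \<open>R\<close> by 0 to negative indices keeps the recurrence valid at every
  integer: for \<open>k <= 0\<close> the factor \<open>1 - Q ^ nat k\<close> is 0. Summation bounds
  can then be moved freely.\<close>

lemma RI_eq: "RI k * (1 - Q ^ nat k) = RI (k - 1)"
proof (cases "k \<le> 0")
  case False
  define m where "m = nat (k - 1)"
  have "nat k = Suc m" "nat (k - 1) = m" "\<not> k < 0" "\<not> k - 1 < 0"
    using False by (auto simp: m_def)
  then show ?thesis
    unfolding RI_def by (simp only: R_Suc if_False)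
qed (simp add: RI_def)

text \<open>The hypothesis is the recurrence \<open>a j = - x * Q ^ (j - 1) * a (j - 1)\<close>,
  multiplied through so that no negative exponent occurs. The step splits
  \<open>1 - Q ^ (m + 1 + n)\<close> as
  \<open>(1 - Q ^ (m + 1 - j)) + Q ^ (m + 1 - j) * (1 - Q ^ (n + j))\<close>.\<close>

lemma finite_theta_step:
  fixes m n :: nat and a :: "int \<Rightarrow> 'a"
  assumes a: "\<And>j. j \<le> int m + 1 \<Longrightarrow> a j * Q ^ nat (int m + 1 - j) = - x * Q ^ m * a (j - 1)"
  shows "(\<Sum>j=-int n..int (Suc m). a j * RI (int (Suc m) - j) * RI (int n + j)) * (1 - Q ^ (Suc m + n))
    = (1 - x * Q ^ m) * (\<Sum>j=-int n..int m. a j * RI (int m - j) * RI (int n + j))"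
proof -
  let ?t = "\<lambda>j. a j * RI (int m - j) * RI (int n + j)"
  have split: "a j * RI (int (Suc m) - j) * RI (int n + j) * (1 - Q ^ (Suc m + n)) = ?t j - x * Q ^ m * ?t (j - 1)"
    if "j \<in> {-int n..int (Suc m)}" for j
  proof -
    have "Suc m + n = nat (int (Suc m) - j) + nat (int n + j)"
      using that by auto
    then have "Q ^ (Suc m + n) = Q ^ nat (int (Suc m) - j) * Q ^ nat (int n + j)"
      by (simp only: power_add)
    then have "a j * RI (int (Suc m) - j) * RI (int n + j) * (1 - Q ^ (Suc m + n))
        = a j * (RI (int (Suc m) - j) * (1 - Q ^ nat (int (Suc m) - j))) * RI (int n + j)
         + (a j * Q ^ nat (int m + 1 - j)) * RI (int (Suc m) - j) * (RI (int n + j) * (1 - Q ^ nat (int n + j)))"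
      by (simp add: algebra_simps)
    also have "\<dots> = ?t j - x * Q ^ m * ?t (j - 1)"
      using that a[of j] by (simp only: RI_eq) (simp add: algebra_simps)
    finally show ?thesis .
  qed
  have "(\<Sum>j=-int n..int (Suc m). a j * RI (int (Suc m) - j) * RI (int n + j)) * (1 - Q ^ (Suc m + n))
    = (\<Sum>j=-int n..int (Suc m). ?t j) - x * Q ^ m * (\<Sum>j=-int n..int (Suc m). ?t (j - 1))"
    unfolding sum_distrib_right sum_distrib_left sum_subtractf[symmetric]
    by (intro sum.cong refl split)
  also have "(\<Sum>j=-int n..int (Suc m). ?t j) = (\<Sum>j=-int n..int m. ?t j)"
    by (rule sum.mono_neutral_right) (auto simp: RI_def)
  also have "(\<Sum>j=-int n..int (Suc m). ?t (j - 1)) = (\<Sum>j=-int n-1..int m. ?t j)"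
    by (rule sum.reindex_bij_witness[of _ "\<lambda>j. j + 1" "\<lambda>j. j - 1"]) auto
  also have "\<dots> = (\<Sum>j=-int n..int m. ?t j)"
    by (rule sum.mono_neutral_right) (auto simp: RI_def)
  finally show ?thesis by (simp add: algebra_simps)
qed

text \<open>The reflection of \<open>j\<close> to \<open>- j\<close> exchanges \<open>m\<close>,
  \<open>x\<close> with \<open>n\<close>, \<open>y\<close>. So the same step lemma first raises
  \<open>n\<close> while \<open>m = 0\<close>, and then raises \<open>m\<close>.\<close>

lemma finite_Jacobi_triple_product:
  fixes m n :: nat and a :: "int \<Rightarrow> 'a"
  assumes a0: "a 0 = 1"
    and ax: "\<And>m j. j \<le> int m + 1 \<Longrightarrow> a j * Q ^ nat (int m + 1 - j) = - x * Q ^ m * a (j - 1)"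
    and ay: "\<And>n j. j \<le> int n + 1 \<Longrightarrow> a (- j) * Q ^ nat (int n + 1 - j) = - y * Q ^ n * a (1 - j)"
  shows "(\<Sum>j=-int n..int m. a j * RI (int m - j) * RI (int n + j)) = qpoch x Q m * qpoch y Q n * R (m + n)"
proof -
  have refl: "(\<Sum>j=-int n..int m. a j * RI (int m - j) * RI (int n + j))
      = (\<Sum>j=-int m..int n. a (- j) * RI (int n - j) * RI (int m + j))" for m n
    by (rule sum.reindex_bij_witness[of _ uminus uminus]) auto
  show ?thesis
  proof (induction m)
    case 0
    show ?case
    proof (induction n)
      case 0
      show ?case using RI_of_nat[of 0] by (simp add: a0)
    next
      case (Suc n)
      have "(\<Sum>j=-int (Suc n)..int 0. a j * RI (int 0 - j) * RI (int (Suc n) + j)) * (1 - Q ^ Suc n)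
          = (1 - y * Q ^ n) * (\<Sum>j=-int n..int 0. a j * RI (int 0 - j) * RI (int n + j))"
        unfolding refl[where m = 0] using finite_theta_step[of n "\<lambda>j. a (- j)" y 0] ay
        by (simp only: add_0_right minus_diff_eq)
      also have "\<dots> = qpoch x Q 0 * qpoch y Q (Suc n) * R (0 + Suc n) * (1 - Q ^ Suc n)"
        unfolding Suc.IH by (simp only: R_Suc[of n, symmetric] qpoch_Suc add_0 mult_ac)
      finally show ?case by (rule mult_one_minus_power_cancel)
    qed
  next
    case (Suc m)
    have "(\<Sum>j=-int n..int (Suc m). a j * RI (int (Suc m) - j) * RI (int n + j)) * (1 - Q ^ Suc (m + n))
        = (1 - x * Q ^ m) * (\<Sum>j=-int n..int m. a j * RI (int m - j) * RI (int n + j))"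
      using finite_theta_step[of m a x n] ax by simp
    also have "\<dots> = qpoch x Q (Suc m) * qpoch y Q n * R (Suc m + n) * (1 - Q ^ Suc (m + n))"
      unfolding Suc.IH by (simp only: R_Suc[of "m + n", symmetric] qpoch_Suc add_Suc mult_ac)
    finally show ?case by (rule mult_one_minus_power_cancel)
  qed
qed

end

subsection \<open>Limits of formal power series\<close>

lemma tendsto_fps_mult:
  fixes F G :: "'a::comm_ring_1 fps"
  assumes "(f \<longlongrightarrow> F) net" and "(g \<longlongrightarrow> G) net"
  shows "((\<lambda>n. f n * g n) \<longlongrightarrow> F * G) net"
proof (rule tendsto_fpsI)
  fix k
  have "\<forall>\<^sub>F n in net. \<forall>i\<in>{..k}. fps_nth (f n) i = fps_nth F i \<and> fps_nth (g n) i = fps_nth G i"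
    using assms by (intro eventually_ball_finite ballI eventually_conj) (auto simp: tendsto_fps_iff)
  then show "\<forall>\<^sub>F n in net. fps_nth (f n * g n) k = fps_nth (F * G) k"
    by eventually_elim (auto simp: fps_mult_nth intro!: sum.cong)
qed

lemma tendsto_fps_prod:
  fixes F :: "'i \<Rightarrow> 'a::comm_ring_1 fps"
  assumes "\<And>i. i \<in> A \<Longrightarrow> (f i \<longlongrightarrow> F i) net"
  shows "((\<lambda>n. \<Prod>i\<in>A. f i n) \<longlongrightarrow> (\<Prod>i\<in>A. F i)) net"
  using assms by (induction A rule: infinite_finite_induct) (auto intro: tendsto_fps_mult)

lemma fps_mult_nth_eq_0:
  fixes F G :: "'a::comm_ring_1 fps"
  assumes "\<And>i. i \<le> k \<Longrightarrow> fps_nth F i = 0"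
  shows "fps_nth (F * G) k = 0"
  using assms by (simp add: fps_mult_nth)

text \<open>\<open>g n - G = (F - f n) * (g n * G)\<close>, and the first factor has no terms up to
  degree \<open>k\<close> once \<open>f n\<close> agrees with \<open>F\<close> there.\<close>

lemma tendsto_fps_reciprocal:
  fixes F G :: "'a::comm_ring_1 fps"
  assumes "(f \<longlongrightarrow> F) net" and fg: "\<And>n. f n * g n = 1" and FG: "F * G = 1"
  shows "(g \<longlongrightarrow> G) net"
proof (rule tendsto_fpsI)
  fix k
  have "\<forall>\<^sub>F n in net. \<forall>i\<in>{..k}. fps_nth (f n) i = fps_nth F i"
    using assms(1) by (intro eventually_ball_finite ballI) (auto simp: tendsto_fps_iff)
  then show "\<forall>\<^sub>F n in net. fps_nth (g n) k = fps_nth G k"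
  proof eventually_elim
    case (elim n)
    have "(F - f n) * (g n * G) = (F * G) * g n - (f n * g n) * G"
      by (simp add: algebra_simps)
    also have "\<dots> = g n - G"
      by (simp add: fg FG)
    finally have "fps_nth (g n - G) k = fps_nth ((F - f n) * (g n * G)) k" by simp
    also have "\<dots> = 0" using elim by (intro fps_mult_nth_eq_0) auto
    finally show ?case by simp
  qed
qed

text \<open>
  The weight \<open>w j\<close> is meant to be a lower bound for the subdegree of \<open>g j\<close>; terms with \<open>w j > k\<close> are
  not consulted for the coefficient of \<open>X\<^sup>k\<close>.
\<close>

definition fps_series :: "('i \<Rightarrow> nat) \<Rightarrow> ('i \<Rightarrow> 'a::comm_ring_1 fps) \<Rightarrow> 'a fps" where
  "fps_series w g = Abs_fps (\<lambda>k. \<Sum>j | w j \<le> k. fps_nth (g j) k)"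

lemma fps_series_nth: "fps_nth (fps_series w g) k = (\<Sum>j | w j \<le> k. fps_nth (g j) k)"
  by (simp add: fps_series_def)

text \<open>A form of dominated convergence: the coefficient of \<open>X ^ k\<close> sees only the
  finitely many \<open>j\<close> with \<open>w j <= k\<close>, and eventually all of these lie in
  \<open>I N\<close> and have reached their limits.\<close>

lemma tendsto_fps_series:
  fixes g :: "'i \<Rightarrow> 'a::comm_ring_1 fps"
  assumes fin: "\<And>k. finite {j. w j \<le> k}" "\<And>N. finite (I N)"
    and ev: "\<And>j. \<forall>\<^sub>F N in net. j \<in> I N"
    and vanish: "\<And>N j k. j \<in> I N \<Longrightarrow> k < w j \<Longrightarrow> fps_nth (f N j) k = 0"
    and lim: "\<And>j. ((\<lambda>N. f N j) \<longlongrightarrow> g j) net"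
  shows "((\<lambda>N. \<Sum>j\<in>I N. f N j) \<longlongrightarrow> fps_series w g) net"
proof (rule tendsto_fpsI)
  fix k
  have "\<forall>\<^sub>F N in net. \<forall>j\<in>{j. w j \<le> k}. j \<in> I N \<and> fps_nth (f N j) k = fps_nth (g j) k"
    using lim by (intro eventually_ball_finite fin ballI eventually_conj ev) (auto simp: tendsto_fps_iff)
  then show "\<forall>\<^sub>F N in net. fps_nth (\<Sum>j\<in>I N. f N j) k = fps_nth (fps_series w g) k"
  proof eventually_elim
    case (elim N)
    have "fps_nth (\<Sum>j\<in>I N. f N j) k = (\<Sum>j | w j \<le> k. fps_nth (f N j) k)"
      unfolding fps_sum_nth
      using elim vanish by (intro sum.mono_neutral_right fin) (auto simp: not_le)
    also have "\<dots> = fps_nth (fps_series w g) k"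
      unfolding fps_series_nth using elim by (intro sum.cong) auto
    finally show ?case .
  qed
qed

lemma fps_series_mult_right:
  fixes g :: "'i \<Rightarrow> 'a::comm_ring_1 fps"
  assumes fin: "\<And>k. finite {j. w j \<le> k}" and vanish: "\<And>j k. k < w j \<Longrightarrow> fps_nth (g j) k = 0"
  shows "fps_series w (\<lambda>j. g j * c) = fps_series w g * c"
proof (rule LIMSEQ_unique)
  have ev: "\<forall>\<^sub>F N in sequentially. j \<in> {j. w j \<le> N}" for j
    using eventually_ge_at_top[of "w j"] by eventually_elim auto
  show "(\<lambda>N. \<Sum>j | w j \<le> N. g j * c) \<longlonglongrightarrow> fps_series w (\<lambda>j. g j * c)"
    by (rule tendsto_fps_series) (use fin ev vanish in \<open>auto intro!: fps_mult_nth_eq_0\<close>)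
  show "(\<lambda>N. \<Sum>j | w j \<le> N. g j * c) \<longlonglongrightarrow> fps_series w g * c"
    unfolding sum_distrib_right[symmetric]
    by (intro tendsto_fps_mult tendsto_const tendsto_fps_series) (use fin ev vanish in auto)
qed

section \<open>Substitution of a power of X, and extraction of residue classes of exponents\<close>

abbreviation dilate :: "nat \<Rightarrow> 'a::idom fps \<Rightarrow> 'a fps" where
  "dilate m F \<equiv> F oo fps_X ^ m"

definition fps_section :: "nat \<Rightarrow> nat \<Rightarrow> 'a fps \<Rightarrow> 'a fps" where
  "fps_section m r F = Abs_fps (\<lambda>n. fps_nth F (m * n + r))"

lemma fps_section_nth [simp]: "fps_nth (fps_section m r F) n = fps_nth F (m * n + r)"
  by (simp add: fps_section_def)

lemma dilate_nth:
  assumes "0 < m"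
  shows "fps_nth (dilate m F) n = (if m dvd n then fps_nth F (n div m) else 0)"
proof -
  have "fps_nth (dilate m F) n = (\<Sum>i=0..n. if n = m * i then fps_nth F i else 0)"
    unfolding fps_compose_nth by (intro sum.cong refl) (simp flip: power_mult)
  also have "\<dots> = (\<Sum>i=0..n. if i = n div m then (if m dvd n then fps_nth F i else 0) else 0)"
    using assms by (intro sum.cong refl) auto
  also have "\<dots> = (if m dvd n then fps_nth F (n div m) else 0)"
    by simp
  finally show ?thesis .
qed

lemma dilate_mult: "0 < m \<Longrightarrow> dilate m (F * G) = dilate m F * dilate m G"
  by (rule fps_compose_mult_distrib) simp

lemma dilate_X_power: "0 < m \<Longrightarrow> dilate m (fps_X ^ k) = (fps_X ^ (m * k) :: 'a::idom fps)"
  by (subst fps_X_power_compose) (simp_all flip: power_mult)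

lemma dilate_dilate: "0 < m \<Longrightarrow> 0 < n \<Longrightarrow> dilate m (dilate n F) = dilate (m * n) F"
  by (auto simp: fps_eq_iff dilate_nth div_mult2_eq dvd_def elim!: dvdE)

lemma tendsto_dilate:
  assumes "0 < m" and "(f \<longlongrightarrow> F) net"
  shows "((\<lambda>n. dilate m (f n)) \<longlongrightarrow> dilate m F) net"
proof (rule tendsto_fpsI)
  fix k
  show "\<forall>\<^sub>F n in net. fps_nth (dilate m (f n)) k = fps_nth (dilate m F) k"
    using assms(2) by (cases "m dvd k") (simp_all add: assms(1) dilate_nth tendsto_fps_iff)
qed

text \<open>A dilated factor has only exponents divisible by \<open>m\<close>, so it does not move
  the residue class of the other factor and can be pulled out.\<close>

lemma fps_section_dilate_mult:
  assumes "r < m"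
  shows "fps_section m r (dilate m F * G) = F * fps_section m r G"
proof (rule fps_ext)
  fix n
  have m: "0 < m" using assms by simp
  have "fps_nth (fps_section m r (dilate m F * G)) n
      = (\<Sum>i\<in>{i. i \<le> m * n + r \<and> m dvd i}. fps_nth F (i div m) * fps_nth G (m * n + r - i))"
    unfolding fps_section_nth fps_mult_nth
    by (rule sum.mono_neutral_cong_right) (auto simp: dilate_nth m)
  also have "\<dots> = (\<Sum>i=0..n. fps_nth F i * fps_nth G (m * (n - i) + r))"
  proof (rule sum.reindex_bij_witness[of _ "\<lambda>i. m * i" "\<lambda>i. i div m"])
    fix i assume i: "i \<in> {i. i \<le> m * n + r \<and> m dvd i}"
    then obtain j where j: "i = m * j" by auto
    \<comment> \<open>Here \<open>r < m\<close> enters: otherwise an index beyond \<open>n\<close>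
      could contribute.\<close>
    have "m * j < m * Suc n" using i j assms by simp
    then have "j \<le> n" by (simp only: mult_less_cancel1 less_Suc_eq_le)
    then show "m * (i div m) = i" "i div m \<in> {0..n}"
      "fps_nth F (i div m) * fps_nth G (m * (n - i div m) + r) = fps_nth F (i div m) * fps_nth G (m * n + r - i)"
      using m j by (auto simp: diff_mult_distrib2)
  next
    fix i assume "i \<in> {0..n}"
    then show "m * i div m = i" "m * i \<in> {i. i \<le> m * n + r \<and> m dvd i}"
      using m by (auto intro: trans_le_add1)
  qed
  also have "\<dots> = fps_nth (F * fps_section m r G) n"
    by (simp add: fps_mult_nth)
  finally show "fps_nth (fps_section m r (dilate m F * G)) n = fps_nth (F * fps_section m r G) n" .
qed

section \<open>Infinite q-Pochhammer products\<close>

definition qpoch_inf :: "'a::comm_ring_1 fps \<Rightarrow> 'a fps \<Rightarrow> 'a fps" where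
  "qpoch_inf x Q = Abs_fps (\<lambda>k. fps_nth (qpoch x Q (Suc k)) k)"

text \<open>Each factor after the first \<open>k + 1\<close> differs from 1 by a multiple of
  \<open>Q ^ (k + 1)\<close>, which has no terms up to degree \<open>k\<close>. This justifies
  reading coefficient \<open>k\<close> off the product of \<open>Suc k\<close> factors in
  \<open>qpoch_inf\<close>.\<close>

lemma qpoch_nth_stable:
  assumes Q: "fps_nth Q 0 = (0::'a::comm_ring_1)" and "k < n"
  shows "fps_nth (qpoch x Q n) k = fps_nth (qpoch_inf x Q) k"
proof -
  have "fps_nth (qpoch x Q (Suc k + m)) k = fps_nth (qpoch x Q (Suc k)) k" for m
  proof (induction m)
    case (Suc m)
    have "qpoch x Q (Suc k + Suc m) = qpoch x Q (Suc k + m) - Q ^ (Suc k + m) * (x * qpoch x Q (Suc k + m))"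
      by (simp add: qpoch_Suc algebra_simps)
    moreover have "fps_nth (Q ^ (Suc k + m) * (x * qpoch x Q (Suc k + m))) k = 0"
      by (rule fps_mult_nth_eq_0) (rule startsby_zero_power_prefix[OF Q, rule_format], simp)
    ultimately show ?case using Suc by simp
  qed simp
  from this[of "n - Suc k"] show ?thesis
    using assms by (simp add: qpoch_inf_def)
qed

lemma tendsto_qpoch_inf:
  assumes "fps_nth Q 0 = (0::'a::comm_ring_1)"
  shows "qpoch x Q \<longlonglongrightarrow> qpoch_inf x Q"
proof (rule tendsto_fpsI)
  fix k
  show "\<forall>\<^sub>F n in sequentially. fps_nth (qpoch x Q n) k = fps_nth (qpoch_inf x Q) k"
    using eventually_gt_at_top[of k] by eventually_elim (rule qpoch_nth_stable[OF assms])
qed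

lemma qpoch_nth_0: "fps_nth x 0 = 0 \<Longrightarrow> fps_nth (qpoch x Q n) 0 = (1::'a::comm_ring_1)"
  by (simp add: qpoch_def fps_nth_0_prod)

lemma qpoch_inf_nth_0: "fps_nth x 0 = 0 \<Longrightarrow> fps_nth (qpoch_inf x Q) 0 = (1::'a::comm_ring_1)"
  by (simp add: qpoch_inf_def qpoch_nth_0)

lemma qpoch_inf_nonzero: "fps_nth x 0 = 0 \<Longrightarrow> qpoch_inf x Q \<noteq> (0::'a::comm_ring_1 fps)"
  using qpoch_inf_nth_0[of x Q] by auto

lemma qpoch_add: "qpoch x Q (m + n) = qpoch x Q m * qpoch (x * Q ^ m) Q n"
  by (induction n) (simp_all add: qpoch_Suc power_add mult_ac)

lemma qpoch_mult: "qpoch x Q (k * n) = (\<Prod>r<k. qpoch (x * Q ^ r) (Q ^ k) n)"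
proof (induction n)
  case (Suc n)
  have "qpoch x Q (k * Suc n) = qpoch x Q (k * n) * qpoch (x * Q ^ (k * n)) Q k"
    by (simp add: qpoch_add[symmetric] add.commute)
  also have "qpoch (x * Q ^ (k * n)) Q k = (\<Prod>r<k. 1 - x * Q ^ r * (Q ^ k) ^ n)"
    unfolding qpoch_def by (simp add: power_mult mult_ac)
  finally show ?case
    unfolding Suc.IH qpoch_Suc prod.distrib .
qed simp

text \<open>The factors are sorted by their index modulo \<open>k\<close>; along the subsequence
  \<open>k * n\<close> every residue class has exactly \<open>n\<close> of them.\<close>

lemma qpoch_inf_split:
  assumes "fps_nth Q 0 = (0::'a::comm_ring_1)" and "0 < k"
  shows "qpoch_inf x Q = (\<Prod>r<k. qpoch_inf (x * Q ^ r) (Q ^ k))"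
proof (rule LIMSEQ_unique)
  have "strict_mono (\<lambda>n. k * n)"
    using assms(2) by (simp add: strict_mono_def)
  from LIMSEQ_subseq_LIMSEQ[OF tendsto_qpoch_inf[OF assms(1)] this]
  show "(\<lambda>n. qpoch x Q (k * n)) \<longlonglongrightarrow> qpoch_inf x Q"
    by (simp add: o_def)
  show "(\<lambda>n. qpoch x Q (k * n)) \<longlonglongrightarrow> (\<Prod>r<k. qpoch_inf (x * Q ^ r) (Q ^ k))"
    unfolding qpoch_mult using assms
    by (intro tendsto_fps_prod tendsto_qpoch_inf) (simp add: fps_nth_power_0 power_0_left)
qed

lemma qpoch_inf_uminus:
  assumes "fps_nth Q 0 = (0::'a::comm_ring_1)"
  shows "qpoch_inf x Q * qpoch_inf (- x) Q = qpoch_inf (x\<^sup>2) (Q\<^sup>2)"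
proof (rule LIMSEQ_unique)
  show "(\<lambda>n. qpoch x Q n * qpoch (- x) Q n) \<longlonglongrightarrow> qpoch_inf x Q * qpoch_inf (- x) Q"
    by (intro tendsto_fps_mult tendsto_qpoch_inf assms)
  have "qpoch x Q n * qpoch (- x) Q n = qpoch (x\<^sup>2) (Q\<^sup>2) n" for n
    unfolding qpoch_def prod.distrib[symmetric]
    by (intro prod.cong refl) (simp add: algebra_simps power2_eq_square power_mult_distrib)
  then show "(\<lambda>n. qpoch x Q n * qpoch (- x) Q n) \<longlonglongrightarrow> qpoch_inf (x\<^sup>2) (Q\<^sup>2)"
    using assms by (simp add: tendsto_qpoch_inf fps_nth_power_0)
qed

lemma dilate_qpoch_inf:
  assumes "fps_nth Q 0 = (0::'a::idom)" and m: "0 < m"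
  shows "dilate m (qpoch_inf x Q) = qpoch_inf (dilate m x) (dilate m Q)"
proof (rule LIMSEQ_unique)
  show "(\<lambda>n. dilate m (qpoch x Q n)) \<longlonglongrightarrow> dilate m (qpoch_inf x Q)"
    by (intro tendsto_dilate m tendsto_qpoch_inf assms)
  have "dilate m (qpoch x Q n) = qpoch (dilate m x) (dilate m Q) n" for n
    unfolding qpoch_def using m
    by (simp add: fps_compose_prod_distrib fps_compose_sub_distrib fps_compose_mult_distrib fps_compose_power)
  then show "(\<lambda>n. dilate m (qpoch x Q n)) \<longlonglongrightarrow> qpoch_inf (dilate m x) (dilate m Q)"
    using assms by (simp add: tendsto_qpoch_inf)
qed

definition fps_recip :: "'a::comm_ring_1 fps \<Rightarrow> 'a fps" where
  "fps_recip F = fps_right_inverse F 1"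

lemma fps_recip: "fps_nth F 0 = 1 \<Longrightarrow> F * fps_recip F = 1"
  unfolding fps_recip_def by (rule fps_right_inverse) simp

definition q_fact_recip :: "'a::comm_ring_1 fps \<Rightarrow> nat \<Rightarrow> 'a fps" where
  "q_fact_recip Q n = fps_recip (qpoch Q Q n)"

lemma q_factorial_inverse_fps:
  assumes "fps_nth Q 0 = 0"
  shows "q_factorial_inverse Q (q_fact_recip Q)"
  by standard (simp add: q_fact_recip_def fps_recip qpoch_nth_0 assms)

lemma tendsto_q_fact_recip:
  assumes "fps_nth Q 0 = 0"
  shows "q_fact_recip Q \<longlonglongrightarrow> fps_recip (qpoch_inf Q Q)"
  unfolding q_fact_recip_def
  by (rule tendsto_fps_reciprocal[of "qpoch Q Q" "qpoch_inf Q Q"])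
    (simp_all add: assms tendsto_qpoch_inf fps_recip qpoch_nth_0 qpoch_inf_nth_0)

subsection \<open>Jacobi's triple product\<close>

definition tri :: "int \<Rightarrow> int" where
  "tri j = j * (j + 1) div 2"

lemma two_tri: "2 * tri j = j * (j + 1)"
  unfolding tri_def by simp

lemma tri_minus: "tri (- j) = tri (j - 1)"
  unfolding tri_def by (rule arg_cong[of _ _ "\<lambda>x. x div 2"]) algebra

lemma tri_ge: "\<bar>j\<bar> \<le> tri j + tri (j - 1)" "0 \<le> tri j"
proof -
  have "2 * (tri j + tri (j - 1)) = 2 * (j * j)"
    using two_tri[of j] two_tri[of "j - 1"] by (simp add: algebra_simps)
  then have "tri j + tri (j - 1) = j * j"
    by simp
  moreover have "\<bar>j\<bar> \<le> j * j"
    using self_le_power[of "\<bar>j\<bar>" 2] by (cases "j = 0") (auto simp: power2_eq_square)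
  ultimately show "\<bar>j\<bar> \<le> tri j + tri (j - 1)" by simp
  have "0 \<le> j * (j + 1)"
    by (cases "0 \<le> j") (auto intro: mult_nonneg_nonneg mult_nonpos_nonpos)
  then show "0 \<le> tri j" by (simp add: tri_def)
qed

definition theta_exp :: "nat \<Rightarrow> nat \<Rightarrow> int \<Rightarrow> int" where
  "theta_exp a b j = int a * tri j + int b * tri (j - 1)"

text \<open>For \<open>s\<^sup>2 = 1\<close> this is Ramanujan's theta function \<open>f(s X\<^sup>a, s X\<^sup>b)\<close>.\<close>

definition theta :: "int \<Rightarrow> nat \<Rightarrow> nat \<Rightarrow> int fps" where
  "theta s a b = Abs_fps (\<lambda>k. \<Sum>j | theta_exp a b j = int k. s ^ nat \<bar>j\<bar>)"

text \<open>This makes every coefficient of \<open>theta\<close> a finite sum and allows the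
  absolute value of \<open>j\<close> as a weight for \<open>fps_series\<close>.\<close>

lemma theta_exp_ge:
  assumes "0 < a" "0 < b"
  shows "\<bar>j\<bar> \<le> theta_exp a b j"
proof -
  have "tri j \<le> int a * tri j" "tri (j - 1) \<le> int b * tri (j - 1)"
    using assms tri_ge(2)[of j] tri_ge(2)[of "j - 1"] by (auto simp: mult_le_cancel_right1)
  then show ?thesis
    using tri_ge(1)[of j] by (simp add: theta_exp_def)
qed

lemma finite_abs_le: "finite {j :: int. nat \<bar>j\<bar> \<le> k}"
  by (rule finite_subset[of _ "{- int k..int k}"]) auto

definition theta_term :: "int \<Rightarrow> nat \<Rightarrow> nat \<Rightarrow> int \<Rightarrow> int fps" where
  "theta_term s a b j = of_int (s ^ nat \<bar>j\<bar>) * fps_X ^ nat (theta_exp a b j)"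

lemma theta_term_nth:
  assumes "0 < a" "0 < b"
  shows "fps_nth (theta_term s a b j) k = (if theta_exp a b j = int k then s ^ nat \<bar>j\<bar> else 0)"
  using theta_exp_ge[OF assms, of j]
  by (auto simp: theta_term_def fps_of_int[symmetric] simp del: of_int_power)

lemma theta_term_uminus: "theta_term s a b (- j) = theta_term s b a j"
proof -
  have "- j - 1 = - (j + 1)"
    by simp
  then have "tri (- j - 1) = tri j"
    by (simp only: tri_minus) simp
  then have "theta_exp a b (- j) = theta_exp b a j"
    by (simp add: theta_exp_def tri_minus add.commute)
  then show ?thesis
    by (simp add: theta_term_def)
qed

lemma theta_eq_fps_series:
  assumes "0 < a" "0 < b"
  shows "theta s a b = fps_series (\<lambda>j. nat \<bar>j\<bar>) (theta_term s a b)"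
proof (rule fps_ext)
  fix k
  have "{j. theta_exp a b j = int k} = {j. nat \<bar>j\<bar> \<le> k} \<inter> {j. theta_exp a b j = int k}"
  proof (rule set_eqI)
    fix j
    show "j \<in> {j. theta_exp a b j = int k} \<longleftrightarrow> j \<in> {j. nat \<bar>j\<bar> \<le> k} \<inter> {j. theta_exp a b j = int k}"
      using theta_exp_ge[OF assms, of j] by auto
  qed
  then show "fps_nth (theta s a b) k = fps_nth (fps_series (\<lambda>j. nat \<bar>j\<bar>) (theta_term s a b)) k"
    unfolding fps_series_nth theta_term_nth[OF assms]
    by (simp add: theta_def sum.If_cases finite_abs_le)
qed

text \<open>Consecutive exponents differ by \<open>a * j + b * (j - 1)\<close>. This is the
  recurrence required by \<open>finite_Jacobi_triple_product\<close> with
  \<open>x = - s * X ^ a\<close> and \<open>Q = X ^ (a + b)\<close>.\<close>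

lemma theta_term_step:
  assumes ab: "0 < a" "0 < b" and s: "s * s = 1" and j: "j \<le> int m + 1"
  shows "theta_term s a b j * (fps_X ^ (a + b)) ^ nat (int m + 1 - j)
    = - (of_int (- s) * fps_X ^ a) * (fps_X ^ (a + b)) ^ m * theta_term s a b (j - 1)"
proof -
  have abs: "s ^ nat \<bar>j\<bar> = s * s ^ nat \<bar>j - 1\<bar>"
  proof (cases "1 \<le> j")
    case True
    then have "nat \<bar>j\<bar> = Suc (nat \<bar>j - 1\<bar>)" by auto
    then show ?thesis by (simp only: power_Suc)
  next
    case False
    then have "nat \<bar>j - 1\<bar> = Suc (nat \<bar>j\<bar>)" by auto
    then show ?thesis by (simp only: power_Suc mult.assoc[symmetric] s mult_1)
  qed
  \<comment> \<open>Doubling removes the integer division in \<open>tri\<close>.\<close>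
  have "2 * (theta_exp a b j + int (a + b) * (int m + 1 - j)) = 2 * (int a + int (a + b) * int m + theta_exp a b (j - 1))"
    unfolding theta_exp_def distrib_left mult.left_commute[of 2] two_tri by (simp add: algebra_simps)
  then have "theta_exp a b j + int (a + b) * (int m + 1 - j) = int a + int (a + b) * int m + theta_exp a b (j - 1)"
    by (simp only: mult_cancel_left) simp
  moreover have "0 \<le> theta_exp a b j" "0 \<le> theta_exp a b (j - 1)"
    using theta_exp_ge[OF ab, of j] theta_exp_ge[OF ab, of "j - 1"] by linarith+
  ultimately have "int (nat (theta_exp a b j) + (a + b) * nat (int m + 1 - j)) = int (a + (a + b) * m + nat (theta_exp a b (j - 1)))"
    using j by simp
  then have "nat (theta_exp a b j) + (a + b) * nat (int m + 1 - j) = a + (a + b) * m + nat (theta_exp a b (j - 1))"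
    by (simp only: of_nat_eq_iff)
  then have "fps_X ^ nat (theta_exp a b j) * (fps_X ^ (a + b)) ^ nat (int m + 1 - j)
      = fps_X ^ a * (fps_X ^ (a + b)) ^ m * (fps_X :: int fps) ^ nat (theta_exp a b (j - 1))"
    unfolding power_mult[symmetric] power_add[symmetric] by (rule arg_cong)
  then show ?thesis
    unfolding theta_term_def abs by (simp add: mult_ac)
qed

text \<open>Let \<open>m = n\<close> tend to infinity in the finite form. All reciprocals tend to
  \<open>R = 1 / (Q; Q)_inf\<close>, and multiplying by the square of its inverse \<open>P\<close>
  removes them.\<close>

lemma Jacobi_triple_product:
  assumes ab: "0 < a" "0 < b" and s: "s * s = 1"
  shows "theta s a b = qpoch_inf (of_int (- s) * fps_X ^ a) (fps_X ^ (a + b))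
    * qpoch_inf (of_int (- s) * fps_X ^ b) (fps_X ^ (a + b)) * qpoch_inf (fps_X ^ (a + b)) (fps_X ^ (a + b))"
proof -
  define Q x y where "Q = (fps_X :: int fps) ^ (a + b)" and "x = of_int (- s) * (fps_X :: int fps) ^ a"
    and "y = of_int (- s) * (fps_X :: int fps) ^ b"
  have Q0: "fps_nth Q 0 = 0"
    using ab by (simp add: Q_def)
  interpret q_factorial_inverse Q "q_fact_recip Q"
    by (rule q_factorial_inverse_fps[OF Q0])
  let ?t = "theta_term s a b"
  define P R where "P = qpoch_inf Q Q" and "R = fps_recip P"
  have PR: "P * R = 1"
    unfolding R_def P_def by (intro fps_recip qpoch_inf_nth_0 Q0)
  have R: "q_fact_recip Q \<longlonglongrightarrow> R"
    unfolding R_def P_def by (rule tendsto_q_fact_recip[OF Q0])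
  have RI: "(\<lambda>n. RI (int n + j)) \<longlonglongrightarrow> R" for j
  proof -
    have "filterlim (\<lambda>n. nat (int n + j)) sequentially sequentially"
      unfolding filterlim_at_top
    proof
      fix Z
      show "\<forall>\<^sub>F n in sequentially. Z \<le> nat (int n + j)"
        using eventually_ge_at_top[of "Z + nat \<bar>j\<bar>"] by eventually_elim linarith
    qed
    from filterlim_compose[OF R this]
    have "(\<lambda>n. q_fact_recip Q (nat (int n + j))) \<longlonglongrightarrow> R" .
    moreover have "\<forall>\<^sub>F n in sequentially. q_fact_recip Q (nat (int n + j)) = RI (int n + j)"
      using eventually_ge_at_top[of "nat \<bar>j\<bar>"] by eventually_elim (auto simp: RI_def)
    ultimately show ?thesis
      by (rule Lim_transform_eventually)
  qed
  have vanish: "fps_nth (?t j * F) k = 0" if "k < nat \<bar>j\<bar>" for j k F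
    using that theta_exp_ge[OF ab, of j]
    by (intro fps_mult_nth_eq_0) (auto simp: theta_term_nth[OF ab])
  have fin: "(\<Sum>j=-int n..int n. ?t j * (RI (int n + - j) * RI (int n + j)))
      = qpoch x Q n * qpoch y Q n * q_fact_recip Q (n + n)" for n
  proof (subst finite_Jacobi_triple_product[where a = ?t, symmetric])
    show "?t 0 = 1"
      by (simp add: theta_term_def theta_exp_def tri_def)
    show "?t j * Q ^ nat (int m + 1 - j) = - x * Q ^ m * ?t (j - 1)" if "j \<le> int m + 1" for m j
      using theta_term_step[OF ab s that] by (simp add: x_def Q_def)
    show "?t (- j) * Q ^ nat (int m + 1 - j) = - y * Q ^ m * ?t (1 - j)" if "j \<le> int m + 1" for m j
      using theta_term_step[OF ab(2,1) s that] theta_term_uminus[of s a b "j - 1"]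
      by (simp add: theta_term_uminus x_def y_def Q_def add.commute)
  qed (simp add: mult.assoc)
  have "(\<lambda>n. \<Sum>j=-int n..int n. ?t j * (RI (int n + - j) * RI (int n + j)))
      \<longlonglongrightarrow> fps_series (\<lambda>j. nat \<bar>j\<bar>) (\<lambda>j. ?t j * (R * R))"
  proof (rule tendsto_fps_series)
    fix j :: int
    show "\<forall>\<^sub>F N in sequentially. j \<in> {-int N..int N}"
      using eventually_ge_at_top[of "nat \<bar>j\<bar>"] by eventually_elim auto
    show "(\<lambda>n. ?t j * (RI (int n + - j) * RI (int n + j))) \<longlonglongrightarrow> ?t j * (R * R)"
      by (intro tendsto_fps_mult tendsto_const RI)
  qed (use finite_abs_le vanish in auto)
  moreover have "fps_series (\<lambda>j. nat \<bar>j\<bar>) (\<lambda>j. ?t j * (R * R)) = theta s a b * (R * R)"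
    using vanish[where F = 1] theta_eq_fps_series[OF ab]
    by (simp add: fps_series_mult_right finite_abs_le)
  ultimately have "(\<lambda>n. qpoch x Q n * qpoch y Q n * q_fact_recip Q (n + n)) \<longlonglongrightarrow> theta s a b * (R * R)"
    unfolding fin by simp
  moreover have "(\<lambda>n. qpoch x Q n * qpoch y Q n * q_fact_recip Q (n + n)) \<longlonglongrightarrow> qpoch_inf x Q * qpoch_inf y Q * R"
  proof (intro tendsto_fps_mult tendsto_qpoch_inf Q0)
    have "strict_mono (\<lambda>n::nat. n + n)"
      by (simp add: strict_mono_def)
    from LIMSEQ_subseq_LIMSEQ[OF R this] show "(\<lambda>n. q_fact_recip Q (n + n)) \<longlonglongrightarrow> R"
      by (simp add: o_def)
  qed
  ultimately have "theta s a b * (R * R) = qpoch_inf x Q * qpoch_inf y Q * R"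
    by (rule LIMSEQ_unique)
  then have "theta s a b * (P * R) * (P * R) = qpoch_inf x Q * qpoch_inf y Q * (P * R) * P"
    by (simp add: mult_ac)
  then have "theta s a b = qpoch_inf x Q * qpoch_inf y Q * P"
    by (simp only: PR mult_1_right)
  then show ?thesis
    by (simp only: P_def Q_def x_def y_def)
qed

subsection \<open>The coefficients with index 1 modulo 3\<close>

abbreviation qX :: "nat \<Rightarrow> nat \<Rightarrow> int fps" where
  "qX a m \<equiv> qpoch_inf (fps_X ^ a) (fps_X ^ m)"

text \<open>The shapes to which limits are applied: the first is the right side of
  \<open>partial_fraction\<close> and \<open>finite_Bailey\<close>, the second the left side of
  \<open>finite_Bailey\<close>. The third identifies plain partial sums with
  \<open>fps_series\<close>.\<close>

lemma tendsto_sum_q_fact_recip: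
  fixes h :: "nat \<Rightarrow> int fps"
  assumes Q: "fps_nth Q 0 = 0" and vanish: "\<And>j k. k < j \<Longrightarrow> fps_nth (h j) k = 0"
  defines "R \<equiv> fps_recip (qpoch_inf Q Q)"
  shows "(\<lambda>N. \<Sum>j\<le>N. h j * (q_fact_recip Q (N - j) * q_fact_recip Q (N + j + 1))) \<longlonglongrightarrow> fps_series (\<lambda>j. j) h * (R * R)"
    and "(\<lambda>N. \<Sum>j\<le>N. h j * q_fact_recip Q (N - j)) \<longlonglongrightarrow> fps_series (\<lambda>j. j) h * R"
    and "(\<lambda>N. \<Sum>j\<le>N. h j) \<longlonglongrightarrow> fps_series (\<lambda>j. j) h"
proof -
  have R: "q_fact_recip Q \<longlonglongrightarrow> R"
    unfolding R_def by (rule tendsto_q_fact_recip[OF Q])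
  have R1: "(\<lambda>N. q_fact_recip Q (N - j)) \<longlonglongrightarrow> R" for j
    by (rule filterlim_compose[OF R filterlim_minus_const_nat_at_top])
  have R2: "(\<lambda>N. q_fact_recip Q (N + j + 1)) \<longlonglongrightarrow> R" for j
    using LIMSEQ_ignore_initial_segment[OF R, of "j + 1"] by (simp add: add.assoc)
  have ev: "\<forall>\<^sub>F N in sequentially. j \<in> {..N}" for j :: nat
    using eventually_ge_at_top[of j] by eventually_elim auto
  have fin: "finite {j::nat. j \<le> k}" for k
    by simp
  have van: "fps_nth (h j * c) k = 0" if "k < j" for j k c
    using that by (intro fps_mult_nth_eq_0 vanish) auto
  have const: "fps_series (\<lambda>j. j) (\<lambda>j. h j * c) = fps_series (\<lambda>j. j) h * c" for c
    by (rule fps_series_mult_right) (auto simp: vanish)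
  show "(\<lambda>N. \<Sum>j\<le>N. h j * (q_fact_recip Q (N - j) * q_fact_recip Q (N + j + 1))) \<longlonglongrightarrow> fps_series (\<lambda>j. j) h * (R * R)"
    unfolding const[symmetric]
    by (rule tendsto_fps_series[OF fin finite_atMost ev van tendsto_fps_mult[OF tendsto_const tendsto_fps_mult[OF R1 R2]]])
  show "(\<lambda>N. \<Sum>j\<le>N. h j * q_fact_recip Q (N - j)) \<longlonglongrightarrow> fps_series (\<lambda>j. j) h * R"
    unfolding const[symmetric]
    by (rule tendsto_fps_series) (auto intro!: fin ev van tendsto_fps_mult[OF tendsto_const] R1)
  show "(\<lambda>N. \<Sum>j\<le>N. h j) \<longlonglongrightarrow> fps_series (\<lambda>j. j) h"
    by (rule tendsto_fps_series) (auto intro!: fin ev vanish)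
qed

section \<open>Geometric and Lambert series\<close>

definition geometric :: "nat \<Rightarrow> int fps" where
  "geometric m = Abs_fps (\<lambda>k. if m dvd k then 1 else 0)"

lemma geometric:
  assumes "0 < m"
  shows "(1 - fps_X ^ m) * geometric m = 1"
proof (rule fps_ext)
  fix k
  show "fps_nth ((1 - fps_X ^ m) * geometric m) k = fps_nth 1 k"
    using assms dvd_minus_self[of m k]
    by (auto simp: left_diff_distrib geometric_def fps_X_power_mult_nth dest: dvd_imp_le)
qed

lemma section_geometric:
  assumes "coprime m n" 
  shows "fps_section n 0 (geometric m) = geometric m"
  using assms by (simp add: fps_eq_iff geometric_def coprime_dvd_mult_right_iff)

text \<open>In closed form this is \<open>(1 - X ^ (12 * j + 6)) / ((1 - X ^ (6 * j + 1)) * (1 - X ^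
  (6 * j + 5)))\<close>, the factor produced by the partial fractions.\<close>

definition lambert_term :: "nat \<Rightarrow> int fps" where
  "lambert_term j = geometric (6 * j + 1) + geometric (6 * j + 5) - 1"

text \<open>Both \<open>6 * j + 1\<close> and \<open>6 * j + 5\<close> are prime to 3, so they
  divide \<open>3 * k\<close> exactly when they divide \<open>k\<close>.\<close>

lemma section_lambert_term: "fps_section 3 0 (lambert_term j) = lambert_term j"
proof -
  have "\<not> 3 dvd 6 * j + 1" "\<not> 3 dvd 6 * j + 5"
    by presburger+
  moreover have "coprime n 3" if "\<not> 3 dvd n" for n :: nat
    using prime_imp_coprime[of 3 n] that by (simp add: coprime_commute)
  ultimately have "coprime (6 * j + 1) 3" "coprime (6 * j + 5) 3"
    by blast+
  then have "fps_section 3 0 (geometric (6 * j + 1)) = geometric (6 * j + 1)"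
    "fps_section 3 0 (geometric (6 * j + 5)) = geometric (6 * j + 5)"
    by (blast intro: section_geometric)+
  then show ?thesis
    by (simp add: lambert_term_def fps_eq_iff)
qed

definition xi_inner :: "int fps" where
  "xi_inner = (\<Sum>n. xi_term (Suc n))"

definition lambert_sum :: "nat \<Rightarrow> int fps" where
  "lambert_sum m = fps_series (\<lambda>j. j) (\<lambda>j. (-1) ^ j * fps_X ^ (m * (j * (j + 1))) * lambert_term j)"

lemma lambert_vanish:
  assumes "0 < m" "k < j"
  shows "fps_nth ((-1) ^ j * fps_X ^ (m * (j * (j + 1))) * lambert_term j * c) k = 0"
proof -
  have "1 * (j * 1) \<le> m * (j * (j + 1))"
    using assms(1) by (intro mult_le_mono) auto
  then have "fps_nth (fps_X ^ (m * (j * (j + 1))) * ((-1) ^ j * lambert_term j * c)) k = 0"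
    using assms(2) by (subst fps_X_power_mult_nth) simp
  then show ?thesis by (simp add: mult_ac)
qed

text \<open>Limits of \<open>finite_Bailey\<close> and of \<open>partial_fraction\<close> for
  \<open>x = X\<close>, \<open>y = X ^ 5\<close>, \<open>Q = X ^ 6\<close>. The power
  \<open>Q ^ (j * (j + 1) div 2)\<close> gives the parameter 3, and the extra
  \<open>Q ^ (j * (j + 1))\<close> in \<open>finite_Bailey\<close> raises it to 9.\<close>

lemma lambert_identities:
  shows "xi_inner * qX 6 6 = fps_X * lambert_sum 9"
    and "lambert_sum 3 * (qX 1 6 * qX 5 6) = qX 6 6 * qX 6 6"
proof -
  define Q :: "int fps" where "Q = fps_X ^ 6"
  have Q0: "fps_nth Q 0 = 0" by (simp add: Q_def)
  interpret q_factorial_inverse Q "q_fact_recip Q"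
    by (rule q_factorial_inverse_fps[OF Q0])
  define W where "W j = geometric (6 * j + 1) * geometric (6 * j + 5)" for j
  have XQ: "fps_X * Q ^ j = fps_X ^ (6 * j + 1)" "fps_X ^ 5 * Q ^ j = fps_X ^ (6 * j + 5)" for j
    by (simp_all add: Q_def power_add mult_ac flip: power_mult)
  have W: "W j * ((1 - fps_X * Q ^ j) * (1 - fps_X ^ 5 * Q ^ j)) = 1" for j
  proof -
    have "W j * ((1 - fps_X * Q ^ j) * (1 - fps_X ^ 5 * Q ^ j))
       = ((1 - fps_X ^ (6 * j + 1)) * geometric (6 * j + 1)) * ((1 - fps_X ^ (6 * j + 5)) * geometric (6 * j + 5))"
      unfolding W_def XQ by (simp only: mult_ac)
    then show ?thesis by (simp only: geometric) simp
  qed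
  have gW: "(1 - Q ^ (2 * j + 1)) * W j = lambert_term j" for j
  proof -
    define u v where "u = geometric (6 * j + 1)" and "v = geometric (6 * j + 5)"
    define a b :: "int fps" where "a = fps_X ^ (6 * j + 1)" and "b = fps_X ^ (6 * j + 5)"
    have uv: "(1 - a) * u = 1" "(1 - b) * v = 1"
      unfolding u_def v_def a_def b_def by (intro geometric; simp)+
    have "Q ^ (2 * j + 1) = a * b"
      unfolding a_def b_def Q_def power_mult[symmetric] power_add[symmetric] by simp
    then have "(1 - Q ^ (2 * j + 1)) * W j = (1 - a * b) * u * v"
      by (simp add: W_def u_def v_def mult.assoc)
    \<comment> \<open>This rests on
      \<open>1 - a * b = (1 - b) + (1 - a) - (1 - a) * (1 - b)\<close>.\<close>
    also have "\<dots> = u * ((1 - b) * v) + v * ((1 - a) * u) - ((1 - a) * u) * ((1 - b) * v)"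
      by (simp add: algebra_simps)
    also have "\<dots> = u + v - 1"
      by (simp only: uv mult_1_right)
    finally show ?thesis
      by (simp add: lambert_term_def u_def v_def)
  qed
  have denom: "xi_denom (Suc n) * (\<Prod>i\<le>n. W i) = 1" for n
  proof -
    have "xi_denom (Suc n) * (\<Prod>i\<le>n. W i) = (\<Prod>i\<le>n. (1 - fps_X * Q ^ i) * (1 - fps_X ^ 5 * Q ^ i) * W i)"
      by (simp add: xi_denom_def qpoch_def Q_def prod.distrib lessThan_Suc_atMost)
    also have "\<dots> = 1"
      using W by (intro prod.neutral) (simp add: mult_ac)
    finally show ?thesis .
  qed
  have recip: "fps_right_inverse (xi_denom (Suc n)) 1 = (\<Prod>i\<le>n. W i)" for n
  proof -
    have "fps_right_inverse (xi_denom (Suc n)) 1 = (xi_denom (Suc n) * (\<Prod>i\<le>n. W i)) * fps_right_inverse (xi_denom (Suc n)) 1"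
      by (simp add: denom)
    also have "\<dots> = (xi_denom (Suc n) * fps_right_inverse (xi_denom (Suc n)) 1) * (\<Prod>i\<le>n. W i)"
      by (simp only: mult_ac)
    finally show ?thesis by (simp add: xi_denom_inverse)
  qed
  have xi_term_Suc: "xi_term (Suc n) = fps_X * (Q ^ (n * (n + 1)) * (\<Prod>i\<le>n. W i))" for n
  proof -
    have "6 * (Suc n)\<^sup>2 - 6 * Suc n + 1 = Suc (6 * (n * (n + 1)))"
      by (simp add: power2_eq_square)
    then show ?thesis
      unfolding xi_term_def recip Q_def by (simp only: power_mult power_Suc mult.assoc)
  qed
  define R where "R = fps_recip (qpoch_inf Q Q)"
  have PR: "qpoch_inf Q Q * R = 1"
    unfolding R_def by (intro fps_recip qpoch_inf_nth_0 Q0)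
  have Qtri: "Q ^ (j * (j + 1) div 2) = fps_X ^ (3 * (j * (j + 1)))" for j :: nat
  proof -
    have "2 * (j * (j + 1) div 2) = j * (j + 1)"
      by (rule dvd_mult_div_cancel) simp
    then have "6 * (j * (j + 1) div 2) = 3 * (j * (j + 1))"
      by linarith
    then show ?thesis by (simp only: Q_def flip: power_mult)
  qed
  have xy: "fps_X * fps_X ^ 5 = Q"
    by (simp add: Q_def flip: power_Suc)

  have vanish: "fps_nth (xi_term (Suc j)) k = 0" if "k < j" for j k
    using that by (intro xi_term_nth_eq_0) simp
  have xi: "xi_inner = fps_series (\<lambda>j. j) (\<lambda>j. xi_term (Suc j))"
    unfolding xi_inner_def
    using summable_LIMSEQ'[OF summable_xi_term] tendsto_sum_q_fact_recip(3)[OF Q0 vanish]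
    by (rule LIMSEQ_unique)
  let ?h = "\<lambda>m j. (-1) ^ j * fps_X ^ (m * (j * (j + 1))) * lambert_term j"
  have "(\<Sum>n\<le>N. xi_term (Suc n) * q_fact_recip Q (N - n))
      = (\<Sum>j\<le>N. (?h 9 j * fps_X) * (q_fact_recip Q (N - j) * q_fact_recip Q (N + j + 1)))" for N
  proof -
    have "(\<Sum>n\<le>N. xi_term (Suc n) * q_fact_recip Q (N - n))
        = fps_X * (\<Sum>n\<le>N. q_fact_recip Q (N - n) * Q ^ (n * (n + 1)) * (\<Prod>i\<le>n. W i))"
      unfolding xi_term_Suc sum_distrib_left by (simp only: mult_ac)
    also have "\<dots> = (\<Sum>j\<le>N. (?h 9 j * fps_X) * (q_fact_recip Q (N - j) * q_fact_recip Q (N + j + 1)))"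
      unfolding finite_Bailey[OF xy W] sum_distrib_left
    proof (intro sum.cong refl)
      fix j
      have "fps_X ^ (9 * (j * (j + 1))) = fps_X ^ (3 * (j * (j + 1))) * Q ^ (j * (j + 1))"
        unfolding Q_def power_mult[symmetric] power_add[symmetric] by simp
      then show "fps_X * ((-1) ^ j * Q ^ (j * (j + 1) div 2) * (1 - Q ^ (2 * j + 1)) * W j * Q ^ (j * (j + 1))
         * q_fact_recip Q (N - j) * q_fact_recip Q (N + j + 1)) =
        (?h 9 j * fps_X) * (q_fact_recip Q (N - j) * q_fact_recip Q (N + j + 1))"
        unfolding Qtri gW[symmetric] by (simp only: mult_ac)
    qed
    finally show ?thesis .
  qed
  moreover have "(\<lambda>N. \<Sum>n\<le>N. xi_term (Suc n) * q_fact_recip Q (N - n)) \<longlonglongrightarrow> xi_inner * R"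
    unfolding xi R_def by (rule tendsto_sum_q_fact_recip(2)[OF Q0 vanish])
  moreover have "(\<lambda>N. \<Sum>j\<le>N. (?h 9 j * fps_X) * (q_fact_recip Q (N - j) * q_fact_recip Q (N + j + 1)))
      \<longlonglongrightarrow> lambert_sum 9 * fps_X * (R * R)"
  proof -
    have "fps_series (\<lambda>j. j) (\<lambda>j. ?h 9 j * fps_X) = lambert_sum 9 * fps_X"
      unfolding lambert_sum_def using lambert_vanish[of 9 _ _ 1]
      by (intro fps_series_mult_right) auto
    moreover have "(\<lambda>N. \<Sum>j\<le>N. (?h 9 j * fps_X) * (q_fact_recip Q (N - j) * q_fact_recip Q (N + j + 1)))
      \<longlonglongrightarrow> fps_series (\<lambda>j. j) (\<lambda>j. ?h 9 j * fps_X) * (R * R)"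
      unfolding R_def by (intro tendsto_sum_q_fact_recip(1) Q0 lambert_vanish) simp_all
    ultimately show ?thesis
      by simp
  qed
  ultimately have "xi_inner * R = lambert_sum 9 * fps_X * (R * R)"
    by (simp only: LIMSEQ_unique)
  note xi_inner_R = this
  have "xi_inner * (qpoch_inf Q Q * R) * qpoch_inf Q Q = (xi_inner * R) * (qpoch_inf Q Q * qpoch_inf Q Q)"
    by (simp only: mult_ac)
  also have "\<dots> = fps_X * lambert_sum 9 * (qpoch_inf Q Q * R) * (qpoch_inf Q Q * R)"
    unfolding xi_inner_R by (simp only: mult_ac)
  finally have "xi_inner * (qpoch_inf Q Q * R) * qpoch_inf Q Q = \<dots>" .
  then show "xi_inner * qX 6 6 = fps_X * lambert_sum 9"
    unfolding PR by (simp add: Q_def)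

  have "(\<Prod>i\<le>n. W i) = (\<Sum>j\<le>n. ?h 3 j * (q_fact_recip Q (n - j) * q_fact_recip Q (n + j + 1)))" for n
    unfolding partial_fraction[OF xy W] Qtri gW[symmetric] by (simp only: mult_ac)
  then have lim: "(\<lambda>n. \<Prod>i\<le>n. W i) \<longlonglongrightarrow> lambert_sum 3 * (R * R)"
    unfolding lambert_sum_def R_def
    using tendsto_sum_q_fact_recip(1)[OF Q0, of "?h 3"] lambert_vanish[of 3 _ _ 1] by simp
  have "(\<lambda>n. xi_denom (Suc n)) \<longlonglongrightarrow> qX 1 6 * qX 5 6"
    unfolding xi_denom_def
    by (intro tendsto_fps_mult LIMSEQ_Suc) (simp_all add: tendsto_qpoch_inf)
  \<comment> \<open>By \<open>denom\<close> the product of the two sequences is constantly 1, so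
    their limits multiply to 1.\<close>
  from tendsto_fps_mult[OF this lim] have "qX 1 6 * qX 5 6 * (lambert_sum 3 * (R * R)) = 1"
    by (simp add: denom LIMSEQ_const_iff)
  then have "lambert_sum 3 * (qX 1 6 * qX 5 6) * (qpoch_inf Q Q * R) * (qpoch_inf Q Q * R) = qpoch_inf Q Q * qpoch_inf Q Q"
    by (simp add: algebra_simps)
  then show "lambert_sum 3 * (qX 1 6 * qX 5 6) = qX 6 6 * qX 6 6"
    unfolding PR by (simp add: Q_def)
qed


lemma section_lambert_sum: "fps_section 3 0 (lambert_sum 9) = lambert_sum 3"
proof (rule fps_ext)
  fix k
  let ?h = "\<lambda>m j. (-1) ^ j * fps_X ^ (m * (j * (j + 1))) * lambert_term j"
  have "fps_nth (?h 9 j) (3 * k) = fps_nth (?h 3 j) k" for j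
  proof -
    have "?h 9 j = dilate 3 (fps_X ^ (3 * (j * (j + 1)))) * ((-1) ^ j * lambert_term j)"
      by (subst dilate_X_power) (simp_all add: mult_ac)
    then have "fps_nth (?h 9 j) (3 * k) = fps_nth (fps_section 3 0 (dilate 3 (fps_X ^ (3 * (j * (j + 1)))) * ((-1) ^ j * lambert_term j))) k"
      by (simp only: fps_section_nth add_0_right)
    also have "\<dots> = fps_nth (fps_X ^ (3 * (j * (j + 1))) * ((-1) ^ j * fps_section 3 0 (lambert_term j))) k"
    proof -
      have "fps_section 3 0 ((-1) ^ j * lambert_term j) = (-1) ^ j * fps_section 3 0 (lambert_term j)"
        by (cases "even j") (simp_all add: fps_eq_iff)
      then show ?thesis by (subst fps_section_dilate_mult) simp_all
    qed
    also have "\<dots> = fps_nth (?h 3 j) k"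
      unfolding section_lambert_term by (simp only: mult_ac)
    finally show ?thesis .
  qed
  then have "fps_nth (fps_section 3 0 (lambert_sum 9)) k = (\<Sum>j | j \<le> 3 * k. fps_nth (?h 3 j) k)"
    by (simp add: lambert_sum_def fps_series_nth)
  \<comment> \<open>The series on the left is cut off at \<open>3 * k\<close>, the one on the right
    at \<open>k\<close>; the terms in between vanish at degree \<open>k\<close>.\<close>
  also have "\<dots> = (\<Sum>j | j \<le> k. fps_nth (?h 3 j) k)"
    using lambert_vanish[of 3 k _ 1] by (intro sum.mono_neutral_right) auto
  finally show "fps_nth (fps_section 3 0 (lambert_sum 9)) k = fps_nth (lambert_sum 3) k"
    by (simp add: lambert_sum_def fps_series_nth)
qed

lemma dilate_qX: "0 < b \<Longrightarrow> 0 < m \<Longrightarrow> dilate m (qX a b) = qX (m * a) (m * b)"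
  by (subst dilate_qpoch_inf) (simp_all add: dilate_X_power)

text \<open>The series \<open>G\<close> of the overview. The factor 2 in \<open>p_xi_3n_1\<close>
  turns congruences modulo 4 for it into congruences modulo 8.\<close>

definition xi3 :: "int fps" where
  "xi3 = fps_section 3 1 xi_inner"

lemma p_xi_3n_1: "p_xi (3 * n + 1) = 2 * fps_nth xi3 n"
proof -
  have "xi = 1 + (xi_inner + xi_inner)"
    by (simp only: xi_def xi_inner_def mult_2)
  then have "fps_nth xi (3 * n + 1) = fps_nth (1 + (xi_inner + xi_inner)) (3 * n + 1)"
    by (rule arg_cong)
  also have "\<dots> = 2 * fps_nth xi_inner (3 * n + 1)"
    unfolding fps_add_nth by simp
  finally show ?thesis
    by (simp add: p_xi_def xi3_def)
qed

text \<open>\<open>qX 6 6\<close> is \<open>qX 2 2\<close> with \<open>X ^ 3\<close> for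
  \<open>X\<close>, so it passes through the section as \<open>qX 2 2\<close>; the factor
  \<open>X\<close> accounts for the residue 1.\<close>

lemma xi3_product: "xi3 * qX 2 2 * (qX 1 6 * qX 5 6) = qX 6 6 * qX 6 6"
proof -
  have "qX 2 2 * xi3 = fps_section 3 1 (dilate 3 (qX 2 2) * xi_inner)"
    unfolding xi3_def by (subst fps_section_dilate_mult) simp_all
  also have "dilate 3 (qX 2 2) * xi_inner = fps_X * lambert_sum 9"
    using lambert_identities(1) by (simp add: dilate_qX mult.commute)
  also have "fps_section 3 1 (fps_X * lambert_sum 9) = lambert_sum 3"
    by (simp add: section_lambert_sum[symmetric] fps_eq_iff)
  finally show ?thesis
    using lambert_identities(2) by (simp add: mult.commute)
qed

subsection \<open>Product identities\<close>

lemma qX_nonzero: "0 < a \<Longrightarrow> qX a m \<noteq> 0"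
  by (rule qpoch_inf_nonzero) simp

lemma qX_split:
  assumes "0 < m" "0 < k"
  shows "qX a m = (\<Prod>r<k. qX (a + m * r) (m * k))"
  using qpoch_inf_split[of "fps_X ^ m" k "fps_X ^ a"] assms
  by (simp add: power_add power_mult)

lemma qX_split_2:
  assumes "0 < m" "b = a + m" "n = 2 * m"
  shows "qX a m = qX a n * qX b n"
  using qX_split[of m 2 a] assms by (simp add: eval_nat_numeral mult.commute)

lemma qX_split_3:
  assumes "0 < m" "b = a + m" "c = a + 2 * m" "n = 3 * m"
  shows "qX a m = qX a n * qX b n * qX c n"
proof -
  have "(\<Prod>r<3. f r) = f 0 * f 1 * f (2::nat)" for f :: "nat \<Rightarrow> int fps"
    by (simp add: eval_nat_numeral)
  from this[of "\<lambda>r. qX (a + m * r) (m * 3)"] show ?thesis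
    using qX_split[of m 3 a] assms by (simp add: mult.commute)
qed

lemma Jacobi_triple_product_plus:
  assumes "0 < a" "0 < b" "c = a + b"
  shows "theta 1 a b = qpoch_inf (- (fps_X ^ a)) (fps_X ^ c) * qpoch_inf (- (fps_X ^ b)) (fps_X ^ c) * qX c c"
  using Jacobi_triple_product[of a b 1] assms by simp

lemma Jacobi_triple_product_minus:
  assumes "0 < a" "0 < b" "c = a + b"
  shows "theta (- 1) a b = qX a c * qX b c * qX c c"
  using Jacobi_triple_product[of a b "- 1"] assms by simp

abbreviation thetaA :: "int fps" where "thetaA \<equiv> theta 1 1 2"
abbreviation thetaB :: "int fps" where "thetaB \<equiv> theta 1 1 5"
abbreviation phi :: "int fps" where "phi \<equiv> theta (- 1) 1 1"
abbreviation pent :: "int fps" where "pent \<equiv> theta (- 1) 1 2"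

lemma phi_product: "phi * qX 2 2 = qX 1 1 * qX 1 1"
proof -
  have "phi = qX 1 2 * qX 1 2 * qX 2 2"
    by (rule Jacobi_triple_product_minus) simp_all
  moreover have "qX 1 1 = qX 1 2 * qX 2 2"
    by (rule qX_split_2) simp_all
  ultimately show ?thesis by (simp add: mult_ac)
qed

text \<open>Euler's pentagonal number theorem: the triple product runs through the three residue
  classes modulo 3.\<close>

lemma pent_product: "pent = qX 1 1"
proof -
  have "pent = qX 1 3 * qX 2 3 * qX 3 3"
    by (rule Jacobi_triple_product_minus) simp_all
  moreover have "qX 1 1 = qX 1 3 * qX 2 3 * qX 3 3"
    by (rule qX_split_3) simp_all
  ultimately show ?thesis by simp
qed

lemma qX_uminus: "0 < m \<Longrightarrow> qX a m * qpoch_inf (- (fps_X ^ a)) (fps_X ^ m) = qX (2 * a) (2 * m)"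
  by (subst qpoch_inf_uminus) (simp_all add: mult.commute flip: power_mult)

text \<open>Each factor \<open>1 + X ^ k\<close> of the triple product is paired with a factor
  \<open>1 - X ^ k\<close> of \<open>qX 1 1\<close>, which doubles the exponents.\<close>

lemma thetaA_product: "thetaA * qX 1 1 * qX 6 6 = qX 2 2 * qX 3 3 * qX 3 3"
proof -
  have "thetaA = qpoch_inf (- (fps_X ^ 1)) (fps_X ^ 3) * qpoch_inf (- (fps_X ^ 2)) (fps_X ^ 3) * qX 3 3"
    by (rule Jacobi_triple_product_plus) simp_all
  moreover have "qX 1 1 = qX 1 3 * qX 2 3 * qX 3 3"
    by (rule qX_split_3) simp_all
  ultimately have "thetaA * qX 1 1 = (qX 1 3 * qpoch_inf (- (fps_X ^ 1)) (fps_X ^ 3))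
      * (qX 2 3 * qpoch_inf (- (fps_X ^ 2)) (fps_X ^ 3)) * qX 3 3 * qX 3 3"
    by (simp only: mult_ac)
  also have "\<dots> = qX 2 6 * qX 4 6 * qX 3 3 * qX 3 3"
    by (subst (1 2) qX_uminus) simp_all
  finally have "thetaA * qX 1 1 = qX 2 6 * qX 4 6 * qX 3 3 * qX 3 3" .
  moreover have "qX 2 2 = qX 2 6 * qX 4 6 * qX 6 6"
    by (rule qX_split_3) simp_all
  ultimately show ?thesis by (simp add: mult_ac)
qed

lemma thetaB_product: "thetaB * (qX 1 6 * qX 5 6) = qX 2 12 * qX 10 12 * qX 6 6"
proof -
  have "thetaB = qpoch_inf (- (fps_X ^ 1)) (fps_X ^ 6) * qpoch_inf (- (fps_X ^ 5)) (fps_X ^ 6) * qX 6 6"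
    by (rule Jacobi_triple_product_plus) simp_all
  then have "thetaB * (qX 1 6 * qX 5 6) = (qX 1 6 * qpoch_inf (- (fps_X ^ 1)) (fps_X ^ 6))
      * (qX 5 6 * qpoch_inf (- (fps_X ^ 5)) (fps_X ^ 6)) * qX 6 6"
    by (simp only: mult_ac)
  also have "\<dots> = qX 2 12 * qX 10 12 * qX 6 6"
    by (subst (1 2) qX_uminus) simp_all
  finally show ?thesis .
qed

text \<open>Inclusion and exclusion on exponents prime to 6: those divisible by 2 or 3 are removed,
  and multiples of 6 are restored.\<close>

lemma qX_6: "qX 1 1 * qX 6 6 = qX 1 6 * qX 5 6 * qX 3 3 * qX 2 2"
proof -
  have "qX 1 1 = qX 1 6 * qX 2 6 * qX 3 6 * qX 4 6 * qX 5 6 * qX 6 6"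
  proof -
    have "qX 1 1 = qX 1 2 * qX 2 2"
      by (rule qX_split_2) simp_all
    moreover have "qX 1 2 = qX 1 6 * qX 3 6 * qX 5 6"
      by (rule qX_split_3) simp_all
    moreover have "qX 2 2 = qX 2 6 * qX 4 6 * qX 6 6"
      by (rule qX_split_3) simp_all
    ultimately show ?thesis
      by (simp only: mult_ac)
  qed
  moreover have "qX 2 2 = qX 2 6 * qX 4 6 * qX 6 6"
    by (rule qX_split_3) simp_all
  moreover have "qX 3 3 = qX 3 6 * qX 6 6"
    by (rule qX_split_2) simp_all
  ultimately show ?thesis by (simp add: mult_ac)
qed

text \<open>Once every series is written as a product, what remains is \<open>qX_6\<close> with
  \<open>X ^ 2\<close> for \<open>X\<close>.\<close>

lemma xi3_phi: "xi3 * dilate 2 phi = thetaB * dilate 6 phi"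
proof -
  have phi2: "dilate 2 phi * qX 4 4 = qX 2 2 * qX 2 2"
    using arg_cong[OF phi_product, of "dilate 2"] by (simp add: dilate_mult dilate_qX del: power_one_right One_nat_def)
  have phi6: "dilate 6 phi * qX 12 12 = qX 6 6 * qX 6 6"
    using arg_cong[OF phi_product, of "dilate 6"] by (simp add: dilate_mult dilate_qX del: power_one_right One_nat_def)
  have q12: "qX 2 2 * qX 12 12 = qX 2 12 * qX 10 12 * qX 6 6 * qX 4 4"
    using arg_cong[OF qX_6, of "dilate 2"] by (simp add: dilate_mult dilate_qX del: power_one_right One_nat_def)
  let ?c = "(qX 1 6 * qX 5 6) * qX 4 4 * qX 12 12"
  have "xi3 * dilate 2 phi * ?c = xi3 * (qX 1 6 * qX 5 6) * (dilate 2 phi * qX 4 4) * qX 12 12"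
    by (simp only: mult_ac)
  also have "\<dots> = (xi3 * qX 2 2 * (qX 1 6 * qX 5 6)) * (qX 2 2 * qX 12 12)"
    unfolding phi2 by (simp only: mult_ac)
  also have "\<dots> = (thetaB * (qX 1 6 * qX 5 6)) * (qX 6 6 * qX 6 6) * qX 4 4"
    unfolding xi3_product q12 thetaB_product by (simp only: mult_ac)
  also have "\<dots> = thetaB * dilate 6 phi * ?c"
    unfolding phi6[symmetric] by (simp only: mult_ac)
  finally have "xi3 * dilate 2 phi * ?c = thetaB * dilate 6 phi * ?c" .
  \<comment> \<open>All factors of \<open>?c\<close> have constant term 1, and integer power series
    form an integral domain, so \<open>?c\<close> cancels.\<close>
  moreover have "?c \<noteq> 0"
    by (simp add: qX_nonzero del: power_one_right One_nat_def)
  ultimately show ?thesis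
    using mult_right_cancel by blast
qed

lemma thetaA_phi: "thetaA * phi = dilate 3 phi * pent"
proof -
  have phi3: "dilate 3 phi * qX 6 6 = qX 3 3 * qX 3 3"
    using arg_cong[OF phi_product, of "dilate 3"] by (simp add: dilate_mult dilate_qX del: power_one_right One_nat_def)
  let ?c = "qX 1 1 * qX 6 6 * qX 2 2"
  have "thetaA * phi * ?c = (thetaA * qX 1 1 * qX 6 6) * (phi * qX 2 2)"
    by (simp only: mult_ac)
  also have "\<dots> = (dilate 3 phi * qX 6 6) * (qX 2 2 * qX 1 1 * qX 1 1)"
    unfolding thetaA_product phi_product phi3 by (simp only: mult_ac)
  also have "\<dots> = dilate 3 phi * pent * ?c"
    unfolding pent_product by (simp only: mult_ac)
  finally have "thetaA * phi * ?c = dilate 3 phi * pent * ?c" .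
  moreover have "?c \<noteq> 0"
    by (simp add: qX_nonzero del: power_one_right One_nat_def)
  ultimately show ?thesis
    using mult_right_cancel by blast
qed

subsection \<open>Congruences modulo 4\<close>

definition fps_cong :: "int \<Rightarrow> int fps \<Rightarrow> int fps \<Rightarrow> bool" where
  "fps_cong m F G \<longleftrightarrow> (\<forall>n. [fps_nth F n = fps_nth G n] (mod m))"

lemma fps_cong_refl [simp]: "fps_cong m F F"
  by (simp add: fps_cong_def)

lemma fps_cong_sym: "fps_cong m F G \<Longrightarrow> fps_cong m G F"
  by (simp add: fps_cong_def cong_sym)

lemma fps_cong_trans [trans]: "fps_cong m F G \<Longrightarrow> fps_cong m G H \<Longrightarrow> fps_cong m F H"
  unfolding fps_cong_def using cong_trans by blast

lemma fps_cong_mult: "fps_cong m F F' \<Longrightarrow> fps_cong m G G' \<Longrightarrow> fps_cong m (F * G) (F' * G')"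
  by (simp add: fps_cong_def fps_mult_nth cong_sum cong_mult)

lemma fps_cong_section: "fps_cong m F G \<Longrightarrow> fps_cong m (fps_section k r F) (fps_section k r G)"
  by (simp add: fps_cong_def)

lemma fps_cong_dilate: "0 < k \<Longrightarrow> fps_cong m F G \<Longrightarrow> fps_cong m (dilate k F) (dilate k G)"
  by (simp add: fps_cong_def dilate_nth)

lemma fps_cong_add_mult: "fps_cong m (F + of_int m * G) F"
  by (simp add: fps_cong_def fps_of_int[symmetric] cong_iff_dvd_diff)

definition squares :: "int fps" where
  "squares = Abs_fps (\<lambda>n. if 0 < n \<and> (\<exists>j. n = j * j) then 1 else 0)"

text \<open>The indices \<open>j\<close> and \<open>- j\<close> give equal terms, and
  \<open>2 * (-1) ^ j\<close> is 2 modulo 4, so the signs disappear. The index 0 is left as the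
  constant 1, which is why \<open>squares\<close> omits it.\<close>

lemma phi_cong: "fps_cong 4 phi (1 + (squares + squares))"
  unfolding fps_cong_def
proof
  fix n
  have exp: "theta_exp 1 1 j = j * j" for j
    using two_tri[of j] two_tri[of "j - 1"] by (simp add: theta_exp_def algebra_simps)
  have phi_n: "fps_nth phi n = (\<Sum>j | j * j = int n. (-1) ^ nat \<bar>j\<bar>)"
    by (simp add: theta_def exp del: One_nat_def)
  show "[fps_nth phi n = fps_nth (1 + (squares + squares)) n] (mod 4)"
  proof (cases "\<exists>j. n = j * j")
    case True
    then obtain i where i: "n = i * i" by auto
    have "{j. j * j = int n} = {int i, - int i}"
      using square_eq_iff[of _ "int i"] by (simp add: i set_eq_iff)
    then have "fps_nth phi n = (if i = 0 then 1 else 2 * (-1) ^ i)"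
      unfolding phi_n by simp
    moreover have "[2 * (-1) ^ i = 2] (mod (4::int))"
      by (cases "even i") (simp_all add: cong_iff_dvd_diff)
    moreover have "fps_nth squares n = (if i = 0 then 0 else 1)"
      using True by (simp add: squares_def i)
    ultimately show ?thesis
      by (simp add: i del: One_nat_def)
  next
    case False
    have "{j. j * j = int n} = {}"
    proof safe
      fix j assume "j * j = int n"
      then have "n = nat \<bar>j\<bar> * nat \<bar>j\<bar>"
        by (metis abs_mult_self_eq nat_int nat_mult_distrib abs_ge_zero)
      then show "j \<in> {}" using False by blast
    qed
    moreover have "n \<noteq> 0" using False by (metis mult_0)
    ultimately show ?thesis
      using False by (simp add: phi_n squares_def del: One_nat_def)
  qed
qed

lemma section_squares: "fps_section 2 0 squares = dilate 2 squares"
proof (rule fps_ext)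
  fix n
  have "(\<exists>j. 2 * n = j * j) \<longleftrightarrow> (\<exists>j::nat. n = 2 * (j * j))"
  proof safe
    fix j :: nat assume j: "2 * n = j * j"
    then have "even j" by (metis dvd_triv_left even_mult_iff)
    then obtain i where "j = 2 * i" by auto
    then show "\<exists>j. n = 2 * (j * j)" using j by (intro exI[of _ i]) simp
  next
    fix j :: nat show "\<exists>i. 2 * (2 * (j * j)) = i * i" by (rule exI[of _ "2 * j"]) simp
  qed
  then show "fps_nth (fps_section 2 0 squares) n = fps_nth (dilate 2 squares) n"
    by (auto simp: squares_def dilate_nth)
qed

lemma section_dilate_coprime:
  assumes "coprime k m" "0 < m"
  shows "fps_section k 0 (dilate m F) = dilate m (fps_section k 0 F)"
  using assms by (auto simp: fps_eq_iff dilate_nth coprime_dvd_mult_right_iff coprime_commute div_mult_swap)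

lemma phi_squared: "fps_cong 4 (phi * phi) 1"
proof -
  have "fps_cong 4 (phi * phi) ((1 + (squares + squares)) * (1 + (squares + squares)))"
    by (intro fps_cong_mult phi_cong)
  also have "(1 + (squares + squares)) * (1 + (squares + squares)) = 1 + of_int 4 * (squares + squares * squares)"
    by (simp add: algebra_simps)
  also have "fps_cong 4 \<dots> 1"
    by (rule fps_cong_add_mult)
  finally show ?thesis .
qed

abbreviation psi :: "int fps" where "psi \<equiv> phi * dilate 3 phi"

lemma dilate_add: "dilate m (F + G) = dilate m F + dilate m G"
  by (rule fps_compose_add_distrib)

lemma psi_cong:
  defines "T \<equiv> squares + dilate 3 squares"
  shows "fps_cong 4 psi (1 + (T + T))"
proof -
  let ?S = "squares" and ?S3 = "dilate 3 squares"
  have "fps_cong 4 (dilate 3 phi) (dilate 3 (1 + (squares + squares)))"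
    by (intro fps_cong_dilate phi_cong) simp
  also have "dilate 3 (1 + (squares + squares)) = 1 + (?S3 + ?S3)"
    by (simp only: dilate_add fps_compose_1)
  finally have "fps_cong 4 psi ((1 + (?S + ?S)) * (1 + (?S3 + ?S3)))"
    by (rule fps_cong_mult[OF phi_cong])
  also have "(1 + (?S + ?S)) * (1 + (?S3 + ?S3)) = 1 + (T + T) + of_int 4 * (?S * ?S3)"
    by (simp add: T_def algebra_simps)
  also have "fps_cong 4 \<dots> (1 + (T + T))"
    by (rule fps_cong_add_mult)
  finally show ?thesis .
qed

text \<open>Modulo 4, \<open>psi\<close> is linear in \<open>squares\<close> and its dilation by 3.
  The even section acts on both as dilation by 2, the second time because 2 and 3 are
  coprime.\<close>

lemma section_psi: "fps_cong 4 (fps_section 2 0 psi) (dilate 2 psi)"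
proof -
  define T where "T = squares + dilate 3 squares"
  have "dilate 3 (dilate 2 squares) = dilate 2 (dilate 3 squares)"
    by (simp add: dilate_dilate)
  then have T: "fps_section 2 0 T = dilate 2 T"
    unfolding T_def dilate_add section_squares[symmetric]
    using section_dilate_coprime[of 2 3 squares] section_squares by (simp add: fps_eq_iff)
  have "fps_cong 4 (fps_section 2 0 psi) (fps_section 2 0 (1 + (T + T)))"
    unfolding T_def by (intro fps_cong_section psi_cong)
  also have "fps_section 2 0 (1 + (T + T)) = 1 + (fps_section 2 0 T + fps_section 2 0 T)"
    by (simp add: fps_eq_iff)
  also have "\<dots> = dilate 2 (1 + (T + T))"
    by (simp only: T dilate_add fps_compose_1)
  also have "fps_cong 4 \<dots> (dilate 2 psi)"
    unfolding T_def by (rule fps_cong_dilate[OF _ fps_cong_sym[OF psi_cong]]) simp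
  finally show ?thesis .
qed

text \<open>Multiply \<open>xi3_phi\<close> by \<open>dilate 2 phi\<close>: the square on the left
  is 1 modulo 4, and the right side becomes \<open>thetaB * dilate 2 psi\<close>.\<close>

lemma xi3_cong: "fps_cong 4 xi3 (thetaB * dilate 2 psi)"
proof -
  have "fps_cong 4 (dilate 2 (phi * phi)) (dilate 2 1)"
    by (intro fps_cong_dilate phi_squared) simp
  then have "fps_cong 4 (xi3 * dilate 2 (phi * phi)) (xi3 * 1)"
    by (intro fps_cong_mult) simp_all
  moreover have "xi3 * dilate 2 (phi * phi) = thetaB * dilate 2 psi"
    using xi3_phi by (simp add: dilate_mult dilate_dilate flip: mult.assoc)
  ultimately show ?thesis
    using fps_cong_sym by simp
qed

section \<open>Bisections of the theta series and of G\<close>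

lemma mult_level_set:
  assumes "0 < m" "c = int m"
  shows "{k. c * f k = int n} = (if m dvd n then {k. f k = int (n div m)} else {})"
proof (cases "m dvd n")
  case True
  then show ?thesis using assms by (auto elim!: dvdE)
next
  case False
  then have "c * f k \<noteq> int n" for k
    unfolding assms(2) by (metis dvd_triv_left int_dvd_int_iff)
  then show ?thesis using False by simp
qed

lemma theta_nth: "fps_nth (theta s a b) k = (\<Sum>j | theta_exp a b j = int k. s ^ nat \<bar>j\<bar>)"
  by (simp add: theta_def)

lemma two_theta_exp: "2 * theta_exp a b j = int (a + b) * j * j + (int a - int b) * j"
  unfolding theta_exp_def distrib_left mult.left_commute[of 2] two_tri by (simp add: algebra_simps)

text \<open>The exponent \<open>3 * j * j - 2 * j\<close> has the parity of \<open>j\<close>. At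
  \<open>2 * j\<close> it is 8 times the pentagonal number \<open>j * (3 * j - 1) / 2\<close>, and
  the section halves it.\<close>

lemma section_thetaB_even: "fps_section 2 0 thetaB = dilate 4 thetaA"
proof (rule fps_ext)
  fix n
  have B: "theta_exp 1 5 j = 3 * j * j - 2 * j" for j
    using two_theta_exp[of 1 5 j] by simp
  have A: "2 * theta_exp 1 2 j = 3 * j * j - j" for j
    using two_theta_exp[of 1 2 j] by simp
  have BA: "theta_exp 1 5 (2 * j) = 8 * theta_exp 1 2 j" for j
    unfolding B using A[of j] by simp
  have ev: "even j" if "theta_exp 1 5 j = int (2 * n)" for j
  proof -
    have *: "3 * j * j = 2 * (j + int n)" using that unfolding B by simp
    have "even (3 * j * j)" unfolding * by simp
    then show ?thesis by simp
  qed
  have "fps_nth (fps_section 2 0 thetaB) n = (\<Sum>j | theta_exp 1 5 j = int (2 * n). 1)"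
    by (simp add: theta_nth)
  also have "\<dots> = (\<Sum>j | 4 * theta_exp 1 2 j = int n. 1)"
  proof (rule sum.reindex_bij_witness[of _ "\<lambda>j. 2 * j" "\<lambda>j. j div 2"])
    fix j assume j: "j \<in> {j. theta_exp 1 5 j = int (2 * n)}"
    then have "even j" using ev by simp
    then show 1: "2 * (j div 2) = j" by simp
    show "j div 2 \<in> {j. 4 * theta_exp 1 2 j = int n}"
      using BA[of "j div 2"] j unfolding 1 by simp
  qed (use BA in auto)
  also have "{j. 4 * theta_exp 1 2 j = int n} = (if 4 dvd n then {j. theta_exp 1 2 j = int (n div 4)} else {})"
    by (rule mult_level_set) simp_all
  also have "(\<Sum>j\<in>\<dots>. 1) = fps_nth (dilate 4 thetaA) n"
    by (simp add: dilate_nth theta_nth)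
  finally show "fps_nth (fps_section 2 0 thetaB) n = fps_nth (dilate 4 thetaA) n" .
qed

text \<open>Odd exponents come from odd indices. Writing these as \<open>1 - 2 * j\<close>
  reproduces the same quadratic form as \<open>4 * theta_exp 1 5 j + 1\<close>, so the series is
  self-similar.\<close>

lemma section_thetaB_odd: "fps_section 2 1 thetaB = dilate 2 thetaB"
proof (rule fps_ext)
  fix n
  have B: "theta_exp 1 5 j = 3 * j * j - 2 * j" for j
    using two_theta_exp[of 1 5 j] by simp
  have BB: "theta_exp 1 5 (1 - 2 * j) = 4 * theta_exp 1 5 j + 1" for j
    unfolding B by (simp add: algebra_simps)
  have odd: "odd j" if "theta_exp 1 5 j = int (2 * n + 1)" for j
  proof -
    have *: "3 * j * j = 2 * (j + int n) + 1" using that unfolding B by simp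
    have "odd (3 * j * j)" unfolding * by simp
    then show ?thesis by simp
  qed
  have "fps_nth (fps_section 2 1 thetaB) n = (\<Sum>j | theta_exp 1 5 j = int (2 * n + 1). 1)"
    by (simp add: theta_nth)
  also have "\<dots> = (\<Sum>j | 2 * theta_exp 1 5 j = int n. 1)"
  proof (rule sum.reindex_bij_witness[of _ "\<lambda>j. 1 - 2 * j" "\<lambda>j. (1 - j) div 2"])
    fix j assume j: "j \<in> {j. theta_exp 1 5 j = int (2 * n + 1)}"
    then have "odd j" using odd by simp
    then show 1: "1 - 2 * ((1 - j) div 2) = j" by simp
    show "(1 - j) div 2 \<in> {j. 2 * theta_exp 1 5 j = int n}"
      using BB[of "(1 - j) div 2"] j unfolding 1 by simp
  qed (use BB in auto)
  also have "{j. 2 * theta_exp 1 5 j = int n} = (if 2 dvd n then {j. theta_exp 1 5 j = int (n div 2)} else {})"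
    by (rule mult_level_set) simp_all
  also have "(\<Sum>j\<in>\<dots>. 1) = fps_nth (dilate 2 thetaB) n"
    by (simp add: dilate_nth theta_nth)
  finally show "fps_nth (fps_section 2 1 thetaB) n = fps_nth (dilate 2 thetaB) n" .
qed

text \<open>Taking odd and then even exponents maps \<open>thetaB * dilate 2 psi\<close> to itself
  modulo 4: the first section dilates \<open>thetaB\<close> and undoes the dilation of
  \<open>psi\<close>, and the second does the reverse.\<close>

lemma xi3_4n_1: "[fps_nth xi3 (4 * n + 1) = fps_nth xi3 n] (mod 4)"
proof -
  have "fps_cong 4 (fps_section 2 1 xi3) (fps_section 2 1 (dilate 2 psi * thetaB))"
    using fps_cong_section[OF xi3_cong] by (simp add: mult.commute)
  also have "fps_section 2 1 (dilate 2 psi * thetaB) = psi * fps_section 2 1 thetaB"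
    by (rule fps_section_dilate_mult) simp
  also have "\<dots> = dilate 2 thetaB * psi"
    unfolding section_thetaB_odd by (rule mult.commute)
  finally have "fps_cong 4 (fps_section 2 0 (fps_section 2 1 xi3)) (fps_section 2 0 (dilate 2 thetaB * psi))"
    by (rule fps_cong_section)
  also have "fps_section 2 0 (dilate 2 thetaB * psi) = thetaB * fps_section 2 0 psi"
    by (rule fps_section_dilate_mult) simp
  also have "fps_cong 4 \<dots> (thetaB * dilate 2 psi)"
    by (intro fps_cong_mult section_psi) simp
  also have "fps_cong 4 \<dots> xi3"
    by (rule fps_cong_sym[OF xi3_cong])
  finally have "[fps_nth (fps_section 2 0 (fps_section 2 1 xi3)) n = fps_nth xi3 n] (mod 4)"
    by (simp only: fps_cong_def)
  then show ?thesis by (simp add: mult.assoc[symmetric])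
qed

text \<open>Two even sections give \<open>thetaA * psi\<close> dilated by 2. By
  \<open>thetaA_phi\<close> this contains the square of \<open>dilate 3 phi\<close>, which is 1
  modulo 4 and leaves \<open>pent\<close>.\<close>

lemma xi3_4n: "[fps_nth xi3 (4 * n) = fps_nth (dilate 2 pent) n] (mod 4)"
proof -
  have "fps_cong 4 (fps_section 2 0 xi3) (fps_section 2 0 (dilate 2 psi * thetaB))"
    using fps_cong_section[OF xi3_cong] by (simp add: mult.commute)
  also have "fps_section 2 0 (dilate 2 psi * thetaB) = psi * fps_section 2 0 thetaB"
    by (rule fps_section_dilate_mult) simp
  also have "fps_section 2 0 thetaB = dilate 2 (dilate 2 thetaA)"
    unfolding section_thetaB_even by (simp add: dilate_dilate)
  also have "psi * \<dots> = \<dots> * psi"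
    by (rule mult.commute)
  finally have "fps_cong 4 (fps_section 2 0 (fps_section 2 0 xi3)) (fps_section 2 0 (dilate 2 (dilate 2 thetaA) * psi))"
    by (rule fps_cong_section)
  also have "fps_section 2 0 (dilate 2 (dilate 2 thetaA) * psi) = dilate 2 thetaA * fps_section 2 0 psi"
    by (rule fps_section_dilate_mult) simp
  also have "fps_cong 4 \<dots> (dilate 2 thetaA * dilate 2 psi)"
    by (intro fps_cong_mult section_psi) simp
  also have "dilate 2 thetaA * dilate 2 psi = dilate 2 (dilate 3 (phi * phi) * pent)"
  proof -
    have "thetaA * psi = dilate 3 (phi * phi) * pent"
      using thetaA_phi by (simp add: dilate_mult flip: mult.assoc)
    then show ?thesis by (simp only: dilate_mult[symmetric] zero_less_numeral)
  qed
  also have "fps_cong 4 \<dots> (dilate 2 (dilate 3 1 * pent))"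
    by (intro fps_cong_dilate fps_cong_mult phi_squared) simp_all
  finally have "[fps_nth (fps_section 2 0 (fps_section 2 0 xi3)) n = fps_nth (dilate 2 pent) n] (mod 4)"
    by (simp add: fps_cong_def)
  then show ?thesis by (simp add: mult.assoc[symmetric])
qed

section \<open>Pentagonal exponents and the final congruences\<close>

lemma dilate_pent_nth: "fps_nth (dilate 2 pent) n = (\<Sum>k | int n = k * (3 * k - 1). (-1) ^ nat \<bar>k\<bar>)"
proof -
  have e: "2 * theta_exp 1 2 k = k * (3 * k - 1)" for k
    using two_theta_exp[of 1 2 k] by (simp add: algebra_simps)
  have "{k. int n = k * (3 * k - 1)} = {k. 2 * theta_exp 1 2 k = int n}"
    unfolding e by (simp only: eq_commute)
  also have "\<dots> = (if 2 dvd n then {k. theta_exp 1 2 k = int (n div 2)} else {})"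
    by (rule mult_level_set) simp_all
  finally show ?thesis
    by (simp add: dilate_nth theta_nth)
qed

text \<open>The difference factors as \<open>(k - l) * (3 * (k + l) - 1)\<close>, and the second
  factor is not divisible by 3, hence nonzero. So each exponent carries a single sign.\<close>

lemma pentagonal_inj:
  assumes "k * (3 * k - 1) = l * (3 * l - (1::int))"
  shows "k = l"
proof -
  have "(k - l) * (3 * (k + l) - 1) = 0"
    using assms by (simp add: algebra_simps)
  moreover have "3 * (k + l) - 1 \<noteq> 0"
    by presburger
  ultimately show ?thesis by simp
qed

lemma cong_double: "[a = b] (mod 4) \<Longrightarrow> [2 * a = 2 * b] (mod (8::int))"
  unfolding cong_iff_dvd_diff by presburger

theorem theorem4p10:
  fixes n :: nat
  shows "[p_xi (48 * n + 4) = p_xi (12 * n + 1)] (mod 8) \<and>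
         (\<forall>k::int. int n = k * (3 * k - 1) \<longrightarrow>
            [p_xi (12 * n + 1) = 2 * (- 1) ^ nat \<bar>k\<bar>] (mod 8)) \<and>
         ((\<nexists>k::int. int n = k * (3 * k - 1)) \<longrightarrow> [p_xi (12 * n + 1) = 0] (mod 8))"
proof (intro conjI allI impI)
  \<comment> \<open>Both indices are 1 modulo 3: \<open>12 * n + 1 = 3 * (4 * n) + 1\<close> and
    \<open>48 * n + 4 = 3 * (4 * (4 * n) + 1) + 1\<close>. The first congruence is therefore
    \<open>xi3_4n_1\<close> at \<open>4 * n\<close>.\<close>
  have p1: "p_xi (12 * n + 1) = 2 * fps_nth xi3 (4 * n)"
    using p_xi_3n_1[of "4 * n"] by simp
  have p4: "p_xi (48 * n + 4) = 2 * fps_nth xi3 (4 * (4 * n) + 1)"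
    using p_xi_3n_1[of "4 * (4 * n) + 1"] by (simp add: algebra_simps)
  have p: "[p_xi (12 * n + 1) = 2 * (\<Sum>k | int n = k * (3 * k - 1). (-1) ^ nat \<bar>k\<bar>)] (mod 8)"
    unfolding p1 dilate_pent_nth[symmetric] by (intro cong_double xi3_4n)
  show "[p_xi (48 * n + 4) = p_xi (12 * n + 1)] (mod 8)"
    unfolding p1 p4 by (intro cong_double xi3_4n_1)
  show "[p_xi (12 * n + 1) = 2 * (- 1) ^ nat \<bar>k\<bar>] (mod 8)" if k: "int n = k * (3 * k - 1)" for k
  proof -
    have "j = k" if "int n = j * (3 * j - 1)" for j
      by (rule pentagonal_inj) (rule trans[OF that[symmetric] k])
    then have "{j. int n = j * (3 * j - 1)} = {k}"
      using k by blast
    then show ?thesis using p by simp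
  qed
  show "[p_xi (12 * n + 1) = 0] (mod 8)" if "\<nexists>k. int n = k * (3 * k - 1)"
    using p that by simp
qed

end
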